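(* Let $\langle v_i\rangle_{i\ge1}$ and $\langle\pi_i\rangle_{i\ge0}$ be sequences generated by DPI or by IPI in the nonlinear optimal control setting, and let $J_i=-v_i$. Assume that for all $i\in\mathbb N$: (A) $\pi_0\in\Pi_{\mathsf a}$; (B) $J_i$ is $\mathrm C^1$ with locally Lipschitz gradient, positive definite, and radially unbounded; (C) if $\gamma\ne1$, then either $x_{\mathsf e}=0$ is globally attractive under $\pi_{i-1}$, or there exists $\kappa_i>0$ such that $\kappa_iJ_i\le c_{\pi_{i-1}}$ pointwise on $\mathcal X$. In the case of IPI, assume in addition that one of the following holds for all $i\in\mathbb N$: (D) if $\gamma\ne1$, then $c_{\pi_{i-1}}$ is radially unbounded and there are $\underline\alpha_i\in[0,\alpha)$ and a function $\zeta_i:\mathcal X\to\mathbb R$ such that for each $x\in\mathcal X$, $\mathbb G_{\pi_{i-1}}^x[C_t]\le\zeta_i(x)\exp(\underline\alpha_it)$ for all $t\in[0,t_{\mathsf{max}}(x;\pi_{i-1}))$; (E) if $\gamma\ne1$, the integral Bellman equation $v_i(x)=\mathbb G_{\pi_{i-1}}^x[\int_0^\eta\gamma^tR_t\,dt+\gamma^\eta v_i(X_\eta)]$ for all $x\in\mathcal X$ holds for arbitrarily small $\eta>0$ (i.e., for every $\varepsilon>0$ there is such an $\eta\in(0,\varepsilon)$). Then: (1) $\pi_{i-1}\in\Pi_{\mathsf a}$ and $J_i=J_{\pi_{i-1}}\ge J_{\pi_i}$ (pointwise) for all $i\in\mathbb N$; (2) for $i\in\mathbb N$, $x_{\mathsf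 e}=0$ under $\pi_{i-1}$ is globally asymptotically stable (hence, globally attractive) if $\alpha J_i(x)<c_{\pi_{i-1}}(x)$ for all $x\in\mathcal X\setminus\{0\}$ (or if $\gamma=1$).
   Context: Nonlinear optimal control setting. State space $\mathcal X=\mathbb R^l$, $\mathcal X^{\mathsf T}=\mathbb R^{1\times l}$, time space $\mathbb T=[0,\infty)$; the action space $\mathcal U\subseteq\mathbb R^m$ (a set $O\cup\partial O$ or $O$ with $O$ open in $\mathbb R^m$) contains $0$. The system is $\dot X_t=f(X_t,U_t)$ with $f:\mathcal X\times\mathcal U\to\mathcal X$ locally Lipschitz and $f(0,0)=0$. The cost function $c:\mathcal X\times\mathcal U\to\mathbb R$ is continuous and positive definite: $c(0,0)=0$ and $c(x,u)>0$ for $(x,u)\ne(0,0)$; the reward is $r=-c$, $R_t=r(X_t,U_t)$, $C_t=-R_t$. $\gamma\in(0,1]$ is the discount factor, $\alpha=-\ln\gamma\ge0$. The Hamiltonian is $h(x,u,p)=r(x,u)+p\,f(x,u)$ (gradients are row vectors), and it is assumed there is a locally Lipschitz $u_*:\mathcal X\times\mathcal X^{\mathsf T}\to\mathcal U$ with $u_*(x,p)\in\arg\max_{u\in\mathcal U}h(x,u,p)$ for all $(x,p)$; this $u_*$ is fixed. A policy is a continuous function $\pi:\mathcal X\to\mathcal U$; write $f_\pi(x)=f(x,\pi(x))$, $c_\pi(x)=c(x,\pi(x))$. $\Pi_0$ is the set of locally Lipschitz policies with $\pi(0)=0$. For a locally Lipschitz policy $\pi$ and $x\in\mathcal X$, $[0,t_{\mathsf{max}}(x;\pi))$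 with $t_{\mathsf{max}}(x;\pi)\in(0,\infty]$ is the maximal forward existence interval of the unique solution of $\dot X_t=f_\pi(X_t)$, $X_0=x$ (global existence is not assumed); $\mathbb G_\pi^x[Y]$ denotes the value of $Y$ along that solution with $U_t=\pi(X_t)$. An integral Bellman equation with horizon $\eta$ at $x$ presupposes that the solution from $x$ exists on $[0,\eta]$. The cost value function is $J_\pi(x)=\mathbb G_\pi^x[\int_0^\infty\gamma^tC_t\,dt]\in[0,\infty]$ if $t_{\mathsf{max}}(x;\pi)=\infty$ and $J_\pi(x)=\infty$ otherwise; $v_\pi=-J_\pi$. $\Pi_{\mathsf a}=\{\pi\in\Pi_0: J_\pi(x)<\infty\ \forall x\in\mathcal X\}$. Standing assumptions: for every $\pi\in\Pi_{\mathsf a}$, $v_\pi$ is $\mathrm C^1$ with locally Lipschitz gradient; for every $\pi\in\Pi_0$, $c_\pi$ is radially nonvanishing, i.e., $\inf_{\|x\|\ge\rho}|c_\pi(x)|\not\to0$ as $\rho\to\infty$. A function $g:\mathcal X\to\mathbb R$ is positive definite iff $g(0)=0$ and $g(x)>0$ for $x\ne0$; radially unbounded iff $\inf_{\|x\|\ge\rho}|g(x)|\to\infty$ as $\rho\to\infty$. $x_{\mathsf e}=0$ is globally attractive under $\pi$ iff $t_{\mathsf{max}}(x;\pi)=\infty$ and $\lim_{t\to\infty}\mathbb G_\pi^x[X_t]=0$ for all $x\in\mathcal X$. DPI: given $\pi_0$, for $i=1,2,\dots$: $v_i:\mathcal X\to\mathbb R$ is a $\mathrm C^1$ function with $\alpha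 v_i(x)=h(x,\pi_{i-1}(x),\nabla v_i(x))$ for all $x$, and $\pi_i(x)=u_*(x,\nabla v_i(x))$. IPI: the same except that, for a fixed $\eta>0$, $v_i$ is a $\mathrm C^1$ function with $v_i(x)=\mathbb G_{\pi_{i-1}}^x[\int_0^\eta\gamma^tR_t\,dt+\gamma^\eta v_i(X_\eta)]$ for all $x$. *)

theory Defs
  imports "HOL-Analysis.Analysis"
begin

text \<open>
  The state space is \<open>real ^ 'l\<close>. Row vectors (gradients, the costate \<open>p\<close>) are also represented
  in \<open>real ^ 'l\<close>, so the product \<open>p f(x,u)\<close> is the inner product. Functions on \<open>\<X> \<times> \<U>\<close> are
  curried total functions; only their values for actions in \<open>U\<close> are ever constrained.
\<close>

subsection \<open>Regularity and definiteness of functions\<close>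

text \<open>The library notion is for time-dependent families; the family here is constant.\<close>

definition loc_lipschitz_on ::
    "'a::metric_space set \<Rightarrow> ('a \<Rightarrow> 'b::metric_space) \<Rightarrow> bool" where
  "loc_lipschitz_on S g \<longleftrightarrow> local_lipschitz (UNIV :: real set) S (\<lambda>_. g)"

definition grad :: "(real ^ 'l \<Rightarrow> real) \<Rightarrow> real ^ 'l \<Rightarrow> real ^ 'l" where
  "grad g x = (THE D. GDERIV g x :> D)"

definition C1 :: "(real ^ 'l \<Rightarrow> real) \<Rightarrow> bool" where
  "C1 g \<longleftrightarrow> (\<forall>x. g differentiable (at x)) \<and> continuous_on UNIV (grad g)"

definition C1_Lip :: "(real ^ 'l \<Rightarrow> real) \<Rightarrow> bool" where
  "C1_Lip g \<longleftrightarrow> C1 g \<and> loc_lipschitz_on UNIV (grad g)"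

definition pos_definite :: "(real ^ 'l \<Rightarrow> real) \<Rightarrow> bool" where
  "pos_definite g \<longleftrightarrow> g 0 = 0 \<and> (\<forall>x. x \<noteq> 0 \<longrightarrow> g x > 0)"

definition outer_inf :: "(real ^ 'l \<Rightarrow> real) \<Rightarrow> real \<Rightarrow> real" where
  "outer_inf g \<rho> = (INF x\<in>{x. norm x \<ge> \<rho>}. \<bar>g x\<bar>)"

definition radially_nonvanishing :: "(real ^ 'l \<Rightarrow> real) \<Rightarrow> bool" where
  "radially_nonvanishing g \<longleftrightarrow> \<not> (outer_inf g \<longlongrightarrow> 0) at_top"

definition radially_unbounded :: "(real ^ 'l \<Rightarrow> real) \<Rightarrow> bool" where
  "radially_unbounded g \<longleftrightarrow> filterlim (outer_inf g) at_top at_top"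

subsection \<open>Trajectories of an autonomous system\<close>

definition solves_on ::
    "(real ^ 'l \<Rightarrow> real ^ 'l) \<Rightarrow> real ^ 'l \<Rightarrow> real set \<Rightarrow> (real \<Rightarrow> real ^ 'l) \<Rightarrow> bool" where
  "solves_on F x I X \<longleftrightarrow>
     X 0 = x \<and> (\<forall>t\<in>I. (X has_vector_derivative F (X t)) (at t within I))"

definition t_max :: "(real ^ 'l \<Rightarrow> real ^ 'l) \<Rightarrow> real ^ 'l \<Rightarrow> ereal" where
  "t_max F x = Sup {ereal T | T. T > 0 \<and> (\<exists>X. solves_on F x {0..<T} X)}"

text \<open>
  For locally Lipschitz \<open>F\<close> the solution on the maximal interval \<open>[0, t_max F x)\<close> exists and is
  unique there, so the choice below is immaterial on that interval. Values outside it are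
  arbitrary and must not be used.
\<close>

definition traj :: "(real ^ 'l \<Rightarrow> real ^ 'l) \<Rightarrow> real ^ 'l \<Rightarrow> real \<Rightarrow> real ^ 'l" where
  "traj F x = (SOME X. solves_on F x {t. 0 \<le> t \<and> ereal t < t_max F x} X)"

definition globally_attractive :: "(real ^ 'l \<Rightarrow> real ^ 'l) \<Rightarrow> bool" where
  "globally_attractive F \<longleftrightarrow> (\<forall>x. t_max F x = \<infinity> \<and> (traj F x \<longlongrightarrow> 0) at_top)"

definition lyapunov_stable :: "(real ^ 'l \<Rightarrow> real ^ 'l) \<Rightarrow> bool" where
  "lyapunov_stable F \<longleftrightarrow>
     (\<forall>\<epsilon>>0. \<exists>\<delta>>0. \<forall>x. norm x < \<delta> \<longrightarrow>
        (\<forall>t\<ge>0. ereal t < t_max F x \<longrightarrow> norm (traj F x t) < \<epsilon>))"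

definition globally_asymp_stable :: "(real ^ 'l \<Rightarrow> real ^ 'l) \<Rightarrow> bool" where
  "globally_asymp_stable F \<longleftrightarrow> lyapunov_stable F \<and> globally_attractive F"

subsection \<open>Policies and value functions\<close>

definition closed_loop ::
    "(real ^ 'l \<Rightarrow> real ^ 'm \<Rightarrow> 'b) \<Rightarrow> (real ^ 'l \<Rightarrow> real ^ 'm) \<Rightarrow> real ^ 'l \<Rightarrow> 'b" where
  "closed_loop g \<pi> x = g x (\<pi> x)"

definition is_policy :: "(real ^ 'm) set \<Rightarrow> (real ^ 'l \<Rightarrow> real ^ 'm) \<Rightarrow> bool" where
  "is_policy U \<pi> \<longleftrightarrow> continuous_on UNIV \<pi> \<and> range \<pi> \<subseteq> U"

definition Pi0 :: "(real ^ 'm) set \<Rightarrow> (real ^ 'l \<Rightarrow> real ^ 'm) set" where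
  "Pi0 U = {\<pi>. is_policy U \<pi> \<and> loc_lipschitz_on UNIV \<pi> \<and> \<pi> 0 = 0}"

definition cost_along ::
    "(real ^ 'l \<Rightarrow> real ^ 'm \<Rightarrow> real ^ 'l) \<Rightarrow> (real ^ 'l \<Rightarrow> real ^ 'm \<Rightarrow> real)
     \<Rightarrow> (real ^ 'l \<Rightarrow> real ^ 'm) \<Rightarrow> real ^ 'l \<Rightarrow> real \<Rightarrow> real" where
  "cost_along f c \<pi> x t = closed_loop c \<pi> (traj (closed_loop f \<pi>) x t)"

definition cost_value ::
    "(real ^ 'l \<Rightarrow> real ^ 'm \<Rightarrow> real ^ 'l) \<Rightarrow> (real ^ 'l \<Rightarrow> real ^ 'm \<Rightarrow> real) \<Rightarrow> real
     \<Rightarrow> (real ^ 'l \<Rightarrow> real ^ 'm) \<Rightarrow> real ^ 'l \<Rightarrow> ennreal" where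
  "cost_value f c \<gamma> \<pi> x =
     (if t_max (closed_loop f \<pi>) x = \<infinity>
      then (\<integral>\<^sup>+t\<in>{0..}. ennreal (\<gamma> powr t * cost_along f c \<pi> x t) \<partial>lborel)
      else \<infinity>)"

definition admissible ::
    "(real ^ 'm) set \<Rightarrow> (real ^ 'l \<Rightarrow> real ^ 'm \<Rightarrow> real ^ 'l)
     \<Rightarrow> (real ^ 'l \<Rightarrow> real ^ 'm \<Rightarrow> real) \<Rightarrow> real \<Rightarrow> (real ^ 'l \<Rightarrow> real ^ 'm) set" where
  "admissible U f c \<gamma> = {\<pi> \<in> Pi0 U. \<forall>x. cost_value f c \<gamma> \<pi> x < \<infinity>}"

text \<open>The real-valued \<open>v\<^sub>\<pi> = - J\<^sub>\<pi>\<close>; meaningful only where the cost value is finite.\<close>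

definition value_fun ::
    "(real ^ 'l \<Rightarrow> real ^ 'm \<Rightarrow> real ^ 'l) \<Rightarrow> (real ^ 'l \<Rightarrow> real ^ 'm \<Rightarrow> real) \<Rightarrow> real
     \<Rightarrow> (real ^ 'l \<Rightarrow> real ^ 'm) \<Rightarrow> real ^ 'l \<Rightarrow> real" where
  "value_fun f c \<gamma> \<pi> x = - enn2real (cost_value f c \<gamma> \<pi> x)"

subsection \<open>Hamiltonian, Bellman equations and policy iteration\<close>

definition hamiltonian ::
    "(real ^ 'l \<Rightarrow> real ^ 'm \<Rightarrow> real ^ 'l) \<Rightarrow> (real ^ 'l \<Rightarrow> real ^ 'm \<Rightarrow> real)
     \<Rightarrow> real ^ 'l \<Rightarrow> real ^ 'm \<Rightarrow> real ^ 'l \<Rightarrow> real" where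
  "hamiltonian f c x u p = - c x u + p \<bullet> f x u"

definition diff_bellman ::
    "(real ^ 'l \<Rightarrow> real ^ 'm \<Rightarrow> real ^ 'l) \<Rightarrow> (real ^ 'l \<Rightarrow> real ^ 'm \<Rightarrow> real) \<Rightarrow> real
     \<Rightarrow> (real ^ 'l \<Rightarrow> real ^ 'm) \<Rightarrow> (real ^ 'l \<Rightarrow> real) \<Rightarrow> bool" where
  "diff_bellman f c \<gamma> \<pi> v \<longleftrightarrow>
     (\<forall>x. - ln \<gamma> * v x = hamiltonian f c x (\<pi> x) (grad v x))"

definition integral_bellman ::
    "(real ^ 'l \<Rightarrow> real ^ 'm \<Rightarrow> real ^ 'l) \<Rightarrow> (real ^ 'l \<Rightarrow> real ^ 'm \<Rightarrow> real) \<Rightarrow> real \<Rightarrow> real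
     \<Rightarrow> (real ^ 'l \<Rightarrow> real ^ 'm) \<Rightarrow> (real ^ 'l \<Rightarrow> real) \<Rightarrow> bool" where
  "integral_bellman f c \<gamma> \<eta> \<pi> v \<longleftrightarrow>
     (\<forall>x. ereal \<eta> < t_max (closed_loop f \<pi>) x \<and>
          v x = integral {0..\<eta>} (\<lambda>t. \<gamma> powr t * (- cost_along f c \<pi> x t))
                + \<gamma> powr \<eta> * v (traj (closed_loop f \<pi>) x \<eta>))"

text \<open>Index conventions: \<open>\<pi> i\<close> is used for \<open>i \<ge> 0\<close>, \<open>v i\<close> only for \<open>i \<ge> 1\<close>.\<close>

definition DPI ::
    "(real ^ 'l \<Rightarrow> real ^ 'm \<Rightarrow> real ^ 'l) \<Rightarrow> (real ^ 'l \<Rightarrow> real ^ 'm \<Rightarrow> real) \<Rightarrow> real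
     \<Rightarrow> (real ^ 'l \<Rightarrow> real ^ 'l \<Rightarrow> real ^ 'm)
     \<Rightarrow> (nat \<Rightarrow> real ^ 'l \<Rightarrow> real) \<Rightarrow> (nat \<Rightarrow> real ^ 'l \<Rightarrow> real ^ 'm) \<Rightarrow> bool" where
  "DPI f c \<gamma> ustar v \<pi> \<longleftrightarrow>
     (\<forall>i\<ge>1. C1 (v i) \<and> diff_bellman f c \<gamma> (\<pi> (i - 1)) (v i) \<and>
            (\<forall>x. \<pi> i x = ustar x (grad (v i) x)))"

definition IPI ::
    "(real ^ 'l \<Rightarrow> real ^ 'm \<Rightarrow> real ^ 'l) \<Rightarrow> (real ^ 'l \<Rightarrow> real ^ 'm \<Rightarrow> real) \<Rightarrow> real
     \<Rightarrow> (real ^ 'l \<Rightarrow> real ^ 'l \<Rightarrow> real ^ 'm) \<Rightarrow> real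
     \<Rightarrow> (nat \<Rightarrow> real ^ 'l \<Rightarrow> real) \<Rightarrow> (nat \<Rightarrow> real ^ 'l \<Rightarrow> real ^ 'm) \<Rightarrow> bool" where
  "IPI f c \<gamma> ustar \<eta> v \<pi> \<longleftrightarrow>
     (\<forall>i\<ge>1. C1 (v i) \<and> integral_bellman f c \<gamma> \<eta> (\<pi> (i - 1)) (v i) \<and>
            (\<forall>x. \<pi> i x = ustar x (grad (v i) x)))"

end

theory Submission
  imports Defs
begin

text \<open>
  Along a trajectory of \<open>\<pi>\<close>, a solution \<open>J\<close> of the differential Bellman equation satisfies
  \<open>(exp (- \<alpha> t) J (X t))' = - exp (- \<alpha> t) c (X t)\<close>. As \<open>J\<close> is nonnegative and radially unbounded,
  this rules out finite escape and bounds the discounted cost by \<open>J\<close>; equality holds once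
  \<open>exp (- \<alpha> t) J (X t) \<longlongrightarrow> 0\<close>, which follows from attractivity (automatic by Lyapunov's theorem when
  \<open>\<gamma> = 1\<close>) or from the integrability of this decreasing quantity when \<open>\<kappa> J \<le> c\<close>. Since the improved
  policy maximises the Hamiltonian, the same identity becomes an inequality along its trajectories,
  which gives the monotonicity.

  The integral Bellman equation iterates to bound the cost value by \<open>J\<close>, so the policy is admissible
  and its cost value is continuous. When \<open>\<gamma> = 1\<close> the trajectories are bounded, because \<open>J\<close> does not
  increase along their samples of period \<open>\<eta>\<close>, and the cost-to-go tends to zero along them, so they
  converge to the origin. In every case \<open>J\<close> therefore equals the cost value, which obeys the Bellman
  equation for all horizons; differentiating at horizon zero returns to the differential case.
\<close>

section \<open>One-sided derivatives and restriction of solutions\<close>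

lemma local_derivative_within:
  fixes X :: "real \<Rightarrow> 'a::real_normed_vector"
  assumes "(X has_vector_derivative D) (at t within S)" "open V" "t \<in> V" "S \<inter> V = T \<inter> V"
  shows "(X has_vector_derivative D) (at t within T)"
proof -
  have "at t within S = at t within T"
    using assms by (intro at_within_nhd[of t V]) auto
  then show ?thesis using assms(1) by simp
qed

lemma integral_has_vector_derivative_atLeast:
  fixes g :: "real \<Rightarrow> 'a::banach"
  assumes "continuous_on {0..} g" "t \<ge> 0"
  shows "((\<lambda>t. integral {0..t} g) has_vector_derivative g t) (at t within {0..})"
proof (rule local_derivative_within)
  show "((\<lambda>t. integral {0..t} g) has_vector_derivative g t) (at t within {0..t+1})"
    using assms by (intro integral_has_vector_derivative continuous_on_subset[OF assms(1)]) auto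
qed (auto intro: open_lessThan[of "t+1"] simp: assms)

lemma ereal_less_if_le: "ereal T \<le> M \<Longrightarrow> t < T \<Longrightarrow> ereal t < M"
  by (metis less_ereal.simps(1) order_less_le_trans)

lemma solves_onD:
  assumes "solves_on F x I X"
  shows "X 0 = x" "t \<in> I \<Longrightarrow> (X has_vector_derivative F (X t)) (at t within I)"
  using assms by (auto simp: solves_on_def)

lemma solves_on_subset:
  assumes "solves_on F x I X" "I' \<subseteq> I"
  shows "solves_on F x I' X"
  using assms by (auto simp: solves_on_def intro: has_vector_derivative_within_subset)

lemma solves_on_continuous:
  assumes "solves_on F x I X"
  shows "continuous_on I X"
  using assms by (auto simp: solves_on_def continuous_on_eq_continuous_within
      intro: has_vector_derivative_continuous)

subsection \<open>Existence and uniqueness of trajectories\<close>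

text \<open>Picard iteration on \<open>Y t = exp (- k t) (X t - x)\<close>: the exponential weight makes the integral
  operator a contraction on the whole half-line, and boundedness of the field keeps it within the
  bounded continuous functions.\<close>

lemma global_solution_of_bounded_lipschitz:
  fixes G :: "real ^ 'l \<Rightarrow> real ^ 'l"
  assumes lip: "L-lipschitz_on UNIV G" and bd: "\<And>x. norm (G x) \<le> M"
  shows "\<exists>X. solves_on G x {0..} X"
proof -
  \<comment> \<open>The weight \<open>k\<close> exceeds \<open>2 * L\<close>, so the contraction
    factor \<open>L / k\<close> is at most 1/2; the summand 1 keeps \<open>k\<close> positive when
    \<open>L = 0\<close>.\<close>
  define k where "k = 2 * L + 1"
  have L: "L \<ge> 0" using lip by (rule lipschitz_on_nonneg)
  then have k: "k > 0" "L / k \<le> 1/2" by (auto simp: k_def field_simps)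
  have M: "M \<ge> 0" using bd[of 0] norm_ge_zero order_trans by blast
  have Gc: "continuous_on UNIV G" using lip by (rule lipschitz_on_continuous_on)
  define g where "g Y s = G (x + exp (k * s) *\<^sub>R apply_bcontfun Y s)"
    for Y :: "real \<Rightarrow>\<^sub>C (real ^ 'l)" and s
  \<comment> \<open>Bounded continuous functions live on the whole line, so \<open>max 0 t\<close>
    extends the operator by the value 0 to negative times.\<close>
  define P where "P Y t = exp (- k * max 0 t) *\<^sub>R integral {0..max 0 t} (g Y)"
    for Y :: "real \<Rightarrow>\<^sub>C (real ^ 'l)" and t
  have gc: "continuous_on S (g Y)" for Y S
    unfolding g_def by (intro continuous_on_compose2[OF Gc] continuous_intros) auto
  have gi: "g Y integrable_on {0..t}" for Y t
    by (intro integrable_continuous_real gc)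
  have P_cont: "continuous_on UNIV (P Y)" for Y
  proof -
    have "continuous_on {0..} (\<lambda>t. integral {0..t} (g Y))"
      using integral_has_vector_derivative_atLeast[OF gc]
      by (auto simp: continuous_on_eq_continuous_within intro!: has_vector_derivative_continuous)
    then have "continuous_on UNIV (\<lambda>t. integral {0..max 0 t} (g Y))"
      by (rule continuous_on_compose2[where g="\<lambda>t. integral {0..t} (g Y)"])
        (auto intro!: continuous_intros)
    then show ?thesis unfolding P_def by (intro continuous_intros)
  qed
  have P_bd: "norm (P Y t) \<le> M / k" for Y t
  proof -
    have "norm (integral {0..max 0 t} (g Y)) \<le> integral {0..max 0 t} (\<lambda>_. M)"
      by (rule Henstock_Kurzweil_Integration.integral_norm_bound_integral) (auto simp: gi g_def bd)
    then have "norm (integral {0..max 0 t} (g Y)) \<le> M * max 0 t" by (simp add: mult.commute)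
    also have "\<dots> \<le> M * (exp (k * max 0 t) / k)"
    proof (rule mult_left_mono)
      have "k * max 0 t \<le> exp (k * max 0 t)" by (smt (verit) exp_ge_add_one_self)
      then show "max 0 t \<le> exp (k * max 0 t) / k"
        using k(1) by (metis mult.commute pos_le_divide_eq)
    qed (rule M)
    finally have "exp (- k * max 0 t) * norm (integral {0..max 0 t} (g Y))
        \<le> exp (- k * max 0 t) * (M * (exp (k * max 0 t) / k))"
      by (intro mult_left_mono) auto
    then have "norm (P Y t) \<le> exp (- k * max 0 t) * (M * (exp (k * max 0 t) / k))"
      by (simp add: P_def)
    also have "\<dots> = M / k" by (simp add: exp_minus field_simps)
    finally show ?thesis .
  qed
  have PB: "P Y \<in> bcontfun" for Y using P_cont P_bd by (rule bcontfun_normI)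
  define Op where "Op Y = Bcontfun (P Y)" for Y
  have Op: "apply_bcontfun (Op Y) = P Y" for Y
    unfolding Op_def using PB by (rule Bcontfun_inverse)
  have contr: "dist (Op Y) (Op Z) \<le> 1/2 * dist Y Z" for Y Z
  proof (rule dist_bound)
    fix t :: real
    define T where "T = max 0 t"
    have T: "T \<ge> 0" by (simp add: T_def)
    define d where "d = dist Y Z"
    have d: "d \<ge> 0" by (simp add: d_def)
    \<comment> \<open>The integral of the Lipschitz bound is at most
      \<open>exp (k * T) * (L / k * d)\<close>; the prefactor \<open>exp (- k * T)\<close> of the
      operator cancels the exponential.\<close>
    have I: "((\<lambda>s. exp (k * s) * (L * d)) has_integral
        exp (k * T) / k * (L * d) - exp (k * 0) / k * (L * d)) {0..T}"
      using T k by (intro fundamental_theorem_of_calculus)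
        (auto simp: has_real_derivative_iff_has_vector_derivative[symmetric]
          intro!: derivative_eq_intros)
    have "norm (integral {0..T} (\<lambda>s. g Y s - g Z s)) \<le> integral {0..T} (\<lambda>s. exp (k * s) * (L * d))"
    proof (rule Henstock_Kurzweil_Integration.integral_norm_bound_integral)
      show "(\<lambda>s. exp (k * s) * (L * d)) integrable_on {0..T}" using I by blast
      fix s
      have "norm (g Y s - g Z s) \<le> L * dist (x + exp (k * s) *\<^sub>R Y s) (x + exp (k * s) *\<^sub>R Z s)"
        unfolding g_def dist_norm[symmetric] by (rule lipschitz_onD[OF lip]) auto
      also have "\<dots> = L * (exp (k * s) * dist (Y s) (Z s))"
        by (simp add: dist_norm scaleR_diff_right[symmetric])
      also have "\<dots> \<le> L * (exp (k * s) * d)"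
        unfolding d_def using L by (intro mult_left_mono dist_bounded) auto
      finally show "norm (g Y s - g Z s) \<le> exp (k * s) * (L * d)" by (simp add: mult_ac)
    qed (auto intro!: integrable_diff gi)
    also have "\<dots> = exp (k * T) / k * (L * d) - exp (k * 0) / k * (L * d)"
      using I by (rule integral_unique)
    also have "\<dots> \<le> exp (k * T) * (L / k * d)" using L d k by simp
    also have "\<dots> \<le> exp (k * T) * (1/2 * d)"
      using k d by (intro mult_left_mono mult_right_mono) auto
    finally have "exp (- k * T) * norm (integral {0..T} (\<lambda>s. g Y s - g Z s))
        \<le> exp (- k * T) * (exp (k * T) * (1/2 * d))"
      by (intro mult_left_mono) auto
    also have "\<dots> = 1/2 * d" by (simp add: exp_minus field_simps)
    also have "integral {0..T} (\<lambda>s. g Y s - g Z s) = integral {0..T} (g Y) - integral {0..T} (g Z)"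
      by (intro integral_diff gi)
    finally show "dist (Op Y t) (Op Z t) \<le> 1/2 * dist Y Z"
      by (simp add: Op P_def T_def[symmetric] d_def dist_norm scaleR_diff_right[symmetric])
  qed
  obtain Y where Y: "Op Y = Y"
    using banach_fix_type[of "1/2" Op] contr by auto
  \<comment> \<open>Undoing the weight: for a fixed point \<open>Y\<close>, the function
    \<open>g Y\<close> is \<open>G\<close> along \<open>X\<close>, so \<open>X\<close> satisfies the
    integral equation.\<close>
  define X where "X t = x + integral {0..t} (g Y)" for t
  have X: "X t = x + exp (k * t) *\<^sub>R Y t" if "t \<ge> 0" for t
  proof -
    have "Y t = P Y t" using Op[of Y] Y by simp
    then show ?thesis using that by (simp add: X_def P_def exp_minus)
  qed
  have "solves_on G x {0..} X"
    unfolding solves_on_def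
  proof (intro conjI ballI)
    show "X 0 = x" by (simp add: X_def)
    fix t :: real assume "t \<in> {0..}"
    then have t: "t \<ge> 0" by simp
    have "(X has_vector_derivative g Y t) (at t within {0..})"
      unfolding X_def using integral_has_vector_derivative_atLeast[OF gc t, of Y]
      by (auto intro!: derivative_eq_intros)
    then show "(X has_vector_derivative G (X t)) (at t within {0..})"
      using X[OF t] by (simp add: g_def)
  qed
  then show ?thesis by blast
qed

section \<open>Uniqueness and continuation of solutions\<close>

lemma loc_lipschitz_on_compact:
  fixes F :: "'a::metric_space \<Rightarrow> 'b::metric_space"
  assumes "loc_lipschitz_on S F" "compact K" "K \<subseteq> S"
  obtains L where "L-lipschitz_on K F"
proof -
  \<comment> \<open>The dummy time parameter is confined to one point, because a uniform constant
    requires time to range over a compact set.\<close>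
  have "local_lipschitz {0::real} K (\<lambda>_. F)"
    using assms(1) unfolding loc_lipschitz_on_def
    by (rule local_lipschitz_subset) (use assms in auto)
  from local_lipschitz_compact_implies_lipschitz[OF this assms(2)] that show ?thesis
    by auto
qed

lemma loc_lipschitz_on_continuous:
  assumes "loc_lipschitz_on S F"
  shows "continuous_on S F"
  using assms local_lipschitz_continuous_on[of UNIV S "\<lambda>_. F"]
  unfolding loc_lipschitz_on_def by auto

text \<open>A Gronwall argument: with \<open>L\<close> a Lipschitz constant on the compact set swept
  out by both solutions, the squared distance weighted by \<open>exp (- 2 L s)\<close> is
  nonincreasing and starts at 0.\<close>

lemma solution_unique:
  fixes F :: "real ^ 'l \<Rightarrow> real ^ 'l"
  assumes lip: "loc_lipschitz_on UNIV F"
    and X: "solves_on F x {0..<T} X" and Y: "solves_on F x {0..<T} Y"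
    and t: "0 \<le> t" "t < T"
  shows "X t = Y t"
proof -
  have Xt: "solves_on F x {0..t} X" and Yt: "solves_on F x {0..t} Y"
    using X Y t by (auto intro: solves_on_subset)
  have "compact (X ` {0..t} \<union> Y ` {0..t})"
    by (intro compact_Un compact_continuous_image solves_on_continuous[OF Xt]
        solves_on_continuous[OF Yt]) auto
  then obtain L where L: "L-lipschitz_on (X ` {0..t} \<union> Y ` {0..t}) F"
    using loc_lipschitz_on_compact[OF lip] by blast
  define \<phi> where "\<phi> s = exp (- (2 * L) * s) * ((X s - Y s) \<bullet> (X s - Y s))" for s
  define \<phi>' where "\<phi>' s = exp (- (2 * L) * s) *
      (2 * ((X s - Y s) \<bullet> (F (X s) - F (Y s))) - 2 * L * ((X s - Y s) \<bullet> (X s - Y s)))" for s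
  have "(\<phi>' has_integral (\<phi> t - \<phi> 0)) {0..t}"
  proof (rule fundamental_theorem_of_calculus)
    fix s assume s: "s \<in> {0..t}"
    have dX: "(X has_derivative (\<lambda>h. h *\<^sub>R F (X s))) (at s within {0..t})"
      and dY: "(Y has_derivative (\<lambda>h. h *\<^sub>R F (Y s))) (at s within {0..t})"
      using solves_onD(2)[OF Xt s] solves_onD(2)[OF Yt s] by (auto simp: has_vector_derivative_def)
    show "(\<phi> has_vector_derivative \<phi>' s) (at s within {0..t})"
      unfolding \<phi>_def \<phi>'_def has_vector_derivative_def
      by (rule derivative_eq_intros dX dY refl)+
        (auto simp: algebra_simps inner_simps inner_commute fun_eq_iff)
  qed (rule t)
  moreover have "\<phi>' s \<le> 0" if s: "s \<in> {0..t}" for s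
  proof -
    have "(X s - Y s) \<bullet> (F (X s) - F (Y s)) \<le> norm (X s - Y s) * norm (F (X s) - F (Y s))"
      by (rule norm_cauchy_schwarz)
    also have "\<dots> \<le> norm (X s - Y s) * (L * norm (X s - Y s))"
      using lipschitz_onD[OF L, of "X s" "Y s"] s
      by (intro mult_left_mono) (auto simp: dist_norm)
    also have "\<dots> = L * ((X s - Y s) \<bullet> (X s - Y s))"
      by (simp add: dot_square_norm power2_eq_square)
    finally show ?thesis unfolding \<phi>'_def by (intro mult_nonneg_nonpos) auto
  qed
  ultimately have "\<phi> t - \<phi> 0 \<le> 0"
    using has_integral_le[of \<phi>' _ "{0..t}" "\<lambda>_. 0" 0] has_integral_0 by blast
  moreover have "\<phi> 0 = 0" using X Y by (simp add: \<phi>_def solves_on_def)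
  ultimately have "(X t - Y t) \<bullet> (X t - Y t) \<le> 0"
    by (simp add: \<phi>_def mult_le_0_iff)
  then show ?thesis using inner_gt_zero_iff[of "X t - Y t"] by (simp add: not_less[symmetric])
qed

text \<open>The case \<open>T = 0\<close>, where the hypothesis on \<open>X\<close> is vacuous, is local existence. The field is
  truncated outside a ball to make it globally Lipschitz.\<close>

lemma bounded_solution_extends:
  fixes F :: "real ^ 'l \<Rightarrow> real ^ 'l"
  assumes lip: "loc_lipschitz_on UNIV F"
    and X: "solves_on F x {0..<T} X" and T: "T \<ge> 0"
    and bd: "norm x \<le> R" "\<And>t. 0 \<le> t \<Longrightarrow> t < T \<Longrightarrow> norm (X t) \<le> R"
  shows "\<exists>T'>T. \<exists>Z. solves_on F x {0..<T'} Z"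
proof -
  \<comment> \<open>The projection is nonexpansive, so \<open>F \<circ> p\<close> is globally
    Lipschitz and bounded. The margin 1 beyond \<open>R\<close> keeps its solution in the ball for a
    short time after \<open>T\<close>, where it still solves the original equation.\<close>
  define p where "p = closest_point (cball (0::real^'l) (R + 1))"
  have R: "R \<ge> 0" using bd(1) norm_ge_zero order_trans by blast
  have p_in: "p y \<in> cball 0 (R + 1)" for y
    unfolding p_def using R by (intro closest_point_in_set) auto
  have p_id: "p y = y" if "norm y \<le> R + 1" for y
    unfolding p_def using that by (intro closest_point_self) auto
  obtain L where L: "L-lipschitz_on (cball 0 (R + 1)) F"
    using loc_lipschitz_on_compact[OF lip, of "cball 0 (R + 1)"] by auto
  define G where "G = F \<circ> p"
  have "1-lipschitz_on UNIV p"
    unfolding p_def using closest_point_lipschitz[of "cball (0::real^'l) (R + 1)"] R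
    by (intro lipschitz_onI) auto
  then have G_lip: "(L * 1)-lipschitz_on UNIV G"
    unfolding G_def
    by (rule lipschitz_on_compose) (rule lipschitz_on_subset[OF L], use p_in in auto)
  have "compact (F ` cball 0 (R + 1))"
    using L by (intro compact_continuous_image lipschitz_on_continuous_on) auto
  then obtain M where M: "\<And>y. y \<in> cball 0 (R + 1) \<Longrightarrow> norm (F y) \<le> M"
    using compact_imp_bounded[of "F ` cball 0 (R + 1)"] by (force simp: bounded_iff)
  obtain Z where Z: "solves_on G x {0..} Z"
    using global_solution_of_bounded_lipschitz[OF G_lip, of M x] M p_in by (auto simp: G_def)
  have G_loc: "loc_lipschitz_on UNIV G"
    unfolding loc_lipschitz_on_def
    by (intro local_lipschitzI exI[of _ 1] conjI exI[of _ "L * 1"] ballI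
        lipschitz_on_subset[OF G_lip]) auto
  have GX: "solves_on G x {0..<T} X"
    using X bd(2) by (force simp: solves_on_def G_def p_id)
  have GZ: "solves_on G x {0..<T} Z" using Z by (rule solves_on_subset) auto
  have ZX: "Z t = X t" if "0 \<le> t" "t < T" for t
    using solution_unique[OF G_loc GZ GX that] .
  have Zc: "continuous_on {0..} Z" using Z by (rule solves_on_continuous)
  \<comment> \<open>At \<open>T\<close> itself the bound comes from the initial value if
    \<open>T = 0\<close>, and otherwise by continuity from earlier times.\<close>
  have ZT: "norm (Z T) \<le> R"
  proof (cases "T = 0")
    case True
    then show ?thesis using Z bd by (simp add: solves_on_def)
  next
    case False
    have "continuous_on (closure {0..<T}) Z" using False T
      by (intro continuous_on_subset[OF Zc]) auto
    then show ?thesis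
      by (rule continuous_on_closure_norm_le) (use False T in \<open>auto simp: ZX bd\<close>)
  qed
  obtain d where d: "d > 0" "\<And>t. 0 \<le> t \<Longrightarrow> dist t T < d \<Longrightarrow> dist (Z t) (Z T) < 1"
    using Zc T unfolding continuous_on_iff by (metis atLeast_iff zero_less_one)
  have small: "norm (Z t) \<le> R + 1" if t: "0 \<le> t" "t < T + d" for t
  proof (cases "t < T")
    case True
    then show ?thesis using ZX[of t] bd(2)[of t] t by simp
  next
    case False
    then have "dist (Z t) (Z T) < 1" using t d by (intro d) (auto simp: dist_real_def)
    then show ?thesis using ZT norm_triangle_sub[of "Z t" "Z T"] by (simp add: dist_norm)
  qed
  have "solves_on G x {0..<T + d} Z" using Z by (rule solves_on_subset) auto
  then have "solves_on F x {0..<T + d} Z"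
    using small by (force simp: solves_on_def G_def p_id)
  then show ?thesis using d(1) by (intro exI[of _ "T + d"]) auto
qed

section \<open>Maximal trajectories of an autonomous system\<close>

locale autonomous =
  fixes F :: "real ^ 'l \<Rightarrow> real ^ 'l"
  assumes lip: "loc_lipschitz_on UNIV F"
begin

lemma le_t_max:
  assumes "solves_on F x {0..<T} X" "T > 0"
  shows "ereal T \<le> t_max F x"
  unfolding t_max_def using assms by (intro Sup_upper) auto

lemma t_max_pos: "0 < t_max F x"
proof -
  have "solves_on F x {0..<0} (\<lambda>_. x)" by (simp add: solves_on_def)
  then obtain T Z where "T > 0" "solves_on F x {0..<T} Z"
    using bounded_solution_extends[OF lip, of x 0 "\<lambda>_. x" "norm x"] by auto
  then show ?thesis using le_t_max[of x T Z] by (smt (verit) ereal_less(2) less_le_trans)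
qed

lemma solution_below_t_max:
  assumes "ereal t < t_max F x"
  shows "\<exists>T X. T > 0 \<and> t < T \<and> solves_on F x {0..<T} X"
  using assms unfolding t_max_def less_Sup_iff by auto

text \<open>This justifies the choice made in \<open>traj\<close>. For each time a solution reaching
  past it is picked; by uniqueness these agree on overlaps, so the diagonal \<open>Z t t\<close>
  solves the equation on the whole maximal interval.\<close>

lemma traj_solves: "solves_on F x {t. 0 \<le> t \<and> ereal t < t_max F x} (traj F x)"
proof -
  let ?D = "{t. 0 \<le> t \<and> ereal t < t_max F x}"
  have "\<forall>t\<in>?D. \<exists>T X. T > 0 \<and> t < T \<and> solves_on F x {0..<T} X"
    using solution_below_t_max by blast
  then obtain T where "\<forall>t\<in>?D. \<exists>X. T t > 0 \<and> t < T t \<and> solves_on F x {0..<T t} X"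
    by (rule bchoice[THEN exE])
  then obtain Z where "\<forall>t\<in>?D. T t > 0 \<and> t < T t \<and> solves_on F x {0..<T t} (Z t)"
    by (rule bchoice[THEN exE])
  then have Z: "\<And>t. t \<in> ?D \<Longrightarrow> 0 < T t" "\<And>t. t \<in> ?D \<Longrightarrow> t < T t"
      "\<And>t. t \<in> ?D \<Longrightarrow> solves_on F x {0..<T t} (Z t)"
    by blast+
  have agree: "Z s s = Z t s" if "t \<in> ?D" "s \<in> ?D" "s < T t" for s t
    by (rule solution_unique[OF lip, of x "min (T s) (T t)"])
      (use that Z(2)[of s] in \<open>auto intro!: solves_on_subset[OF Z(3)]\<close>)
  have "solves_on F x ?D (\<lambda>t. Z t t)"
    unfolding solves_on_def
  proof (intro conjI ballI)
    have "0 \<in> ?D" using t_max_pos[of x] by (simp add: zero_ereal_def)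
    then show "Z 0 0 = x" using Z(3) solves_onD(1) by blast
    fix t assume t: "t \<in> ?D"
    have sub: "{0..<T t} \<subseteq> ?D"
      using le_t_max[OF Z(3)[OF t] Z(1)[OF t]] by (auto intro: ereal_less_if_le)
    have "(Z t has_vector_derivative F (Z t t)) (at t within {0..<T t})"
      using t Z(2)[OF t] by (intro solves_onD(2)[OF Z(3)]) auto
    then have "((\<lambda>t. Z t t) has_vector_derivative F (Z t t)) (at t within {0..<T t})"
    proof (rule has_vector_derivative_transform[rotated 2])
      show "t \<in> {0..<T t}" using t Z(2)[OF t] by auto
    qed (use agree[OF t] sub in auto)
    then show "((\<lambda>t. Z t t) has_vector_derivative F (Z t t)) (at t within ?D)"
      by (rule local_derivative_within[where V="{..<T t}"]) (use t Z(2)[OF t] sub in auto)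
  qed
  then show ?thesis unfolding traj_def by (rule someI[where P="solves_on F x ?D"])
qed

lemma traj_0 [simp]: "traj F x 0 = x"
  using traj_solves solves_onD(1) by blast

lemma traj_solves_on:
  assumes "I \<subseteq> {0..}" "\<And>t. t \<in> I \<Longrightarrow> ereal t < t_max F x"
  shows "solves_on F x I (traj F x)"
  using assms by (intro solves_on_subset[OF traj_solves]) auto

lemma traj_unique:
  assumes "solves_on F x {0..<T} Y" "0 \<le> t" "t < T"
  shows "traj F x t = Y t"
proof -
  have "ereal T \<le> t_max F x" using assms by (intro le_t_max) auto
  then have "solves_on F x {0..<T} (traj F x)"
    by (intro traj_solves_on) (auto intro: ereal_less_if_le)
  then show ?thesis using solution_unique[OF lip _ assms] by blast
qed

text \<open>The blow-up alternative: a trajectory bounded up to a finite maximal time could be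
  continued past it.\<close>

lemma t_max_eq_infinityI:
  assumes "\<And>T. T > 0 \<Longrightarrow> t_max F x = ereal T \<Longrightarrow> \<exists>R. \<forall>t. 0 \<le> t \<and> t < T \<longrightarrow> norm (traj F x t) \<le> R"
  shows "t_max F x = \<infinity>"
proof (rule ccontr)
  assume "t_max F x \<noteq> \<infinity>"
  then obtain T where T: "t_max F x = ereal T" using t_max_pos[of x] by (cases "t_max F x") auto
  with t_max_pos[of x] have T0: "T > 0" by simp
  obtain R where R: "\<And>t. 0 \<le> t \<Longrightarrow> t < T \<Longrightarrow> norm (traj F x t) \<le> R" using assms[OF T0 T] by blast
  have "solves_on F x {0..<T} (traj F x)" using T by (intro traj_solves_on) auto
  moreover have "norm x \<le> R" using R[of 0] T0 by simp
  ultimately obtain T' Z where "T' > T" "solves_on F x {0..<T'} Z"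
    using bounded_solution_extends[OF lip, of x T "traj F x" R] R T0 by auto
  then show False using le_t_max[of x T' Z] T T0 by auto
qed

text \<open>As the interval is half-open, \<open>s + T\<close> may equal the maximal time, which
  allows restarting on the last stretch before a supposed escape.\<close>

lemma solves_on_shift:
  assumes s: "0 \<le> s" "ereal (s + T) \<le> t_max F x"
  shows "solves_on F (traj F x s) {0..<T} (\<lambda>t. traj F x (s + t))"
  unfolding solves_on_def
proof (intro conjI ballI)
  fix t assume t: "t \<in> {0..<T}"
  have sol: "solves_on F x {0..<s + T} (traj F x)"
    using s by (intro traj_solves_on) (auto intro: ereal_less_if_le)
  have "((\<lambda>t. s + t) has_vector_derivative 1) (at t within {0..<T})"
    by (auto intro!: derivative_eq_intros)
  moreover have "(traj F x has_vector_derivative F (traj F x (s + t))) (at (s + t) within (\<lambda>t. s + t) ` {0..<T})"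
    using s t by (intro has_vector_derivative_within_subset[OF solves_onD(2)[OF sol]]) auto
  ultimately have "(traj F x \<circ> (\<lambda>t. s + t) has_vector_derivative 1 *\<^sub>R F (traj F x (s + t))) (at t within {0..<T})"
    by (rule vector_diff_chain_within)
  then show "((\<lambda>t. traj F x (s + t)) has_vector_derivative F (traj F x (s + t))) (at t within {0..<T})"
    by (simp add: o_def)
qed simp

lemma traj_add:
  assumes "t_max F x = \<infinity>" "0 \<le> s" "0 \<le> t"
  shows "traj F (traj F x s) t = traj F x (s + t)"
  using traj_unique[OF solves_on_shift[of s "t + 1" x], of t] assms by simp

lemma traj_deriv:
  assumes "t_max F x = \<infinity>" "t \<ge> 0"
  shows "(traj F x has_vector_derivative F (traj F x t)) (at t within {0..})"
  using solves_onD(2)[OF traj_solves_on[of "{0..}" x]] assms by auto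

lemma traj_continuous:
  assumes "t_max F x = \<infinity>"
  shows "continuous_on {0..} (traj F x)"
  using solves_on_continuous[OF traj_solves_on[of "{0..}" x]] assms by auto

text \<open>An integral Bellman equation presupposes existence up to \<open>\<eta>\<close> from
  every state. Restarting at most \<open>\<eta>\<close> before a supposed escape time gives a
  trajectory that is continuous on a compact interval covering the remaining time, hence bounded,
  and that coincides with the original one.\<close>

lemma uniform_existence_imp_global:
  assumes "\<eta> > 0" and ex: "\<And>x. ereal \<eta> < t_max F x"
  shows "t_max F x = \<infinity>"
proof (rule t_max_eq_infinityI)
  fix T assume T: "T > 0" "t_max F x = ereal T"
  define s where "s = max 0 (T - \<eta>)"
  have s: "0 \<le> s" "s < T" "T - s \<le> \<eta>" using T assms(1) by (auto simp: s_def)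
  have eq: "traj F (traj F x s) t = traj F x (s + t)" if "0 \<le> t" "t < T - s" for t
    using traj_unique[OF solves_on_shift[of s "T - s" x]] s T that by simp
  have c1: "continuous_on {0..\<eta>} (traj F (traj F x s))"
    using ex[of "traj F x s"]
    by (intro solves_on_continuous[OF traj_solves_on]) (auto intro: le_less_trans[of _ "ereal \<eta>"])
  have c2: "continuous_on {0..s} (traj F x)"
    using s T by (intro solves_on_continuous[OF traj_solves_on]) auto
  have "bounded (traj F (traj F x s) ` {0..\<eta>} \<union> traj F x ` {0..s})"
    by (intro compact_imp_bounded compact_Un compact_continuous_image c1 c2) auto
  then obtain R where R: "\<And>y. y \<in> traj F (traj F x s) ` {0..\<eta>} \<union> traj F x ` {0..s} \<Longrightarrow> norm y \<le> R"
    unfolding bounded_iff by blast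
  have "norm (traj F x t) \<le> R" if "0 \<le> t" "t < T" for t
  proof (cases "t \<le> s")
    case False
    then have "traj F x t = traj F (traj F x s) (t - s)" using eq[of "t - s"] that by simp
    then show ?thesis using R[of "traj F x t"] False that s by auto
  qed (use R that in auto)
  then show "\<exists>R. \<forall>t. 0 \<le> t \<and> t < T \<longrightarrow> norm (traj F x t) \<le> R" by blast
qed

end

subsection \<open>Gradients and definite functions\<close>

lemma GDERIV_unique:
  assumes "GDERIV g x :> D" "GDERIV g x :> D'"
  shows "D = D'"
proof -
  have "(\<lambda>h. h \<bullet> D) = (\<lambda>h. h \<bullet> D')"
    using assms unfolding gderiv_def by (rule has_derivative_unique)
  then have "\<forall>h. h \<bullet> D = h \<bullet> D'" by (simp add: fun_eq_iff)
  then show ?thesis by (simp only: vector_eq_ldot)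
qed

lemma GDERIV_grad:
  assumes "g differentiable (at x)"
  shows "GDERIV g x :> grad g x"
proof -
  obtain g' where g': "(g has_derivative g') (at x)"
    using assms by (auto simp: differentiable_def)
  \<comment> \<open>The gradient is the Riesz representer of the derivative, that is, the adjoint
    applied to the scalar 1.\<close>
  have "h \<bullet> adjoint g' 1 = g' h" for h
    using adjoint_works[OF has_derivative_linear[OF g']] by simp
  then have D: "GDERIV g x :> adjoint g' 1"
    using g' by (simp add: gderiv_def)
  then show ?thesis unfolding grad_def by (rule theI) (rule GDERIV_unique[OF _ D])
qed

lemma grad_eqI:
  assumes "GDERIV g x :> D"
  shows "grad g x = D"
proof -
  have "GDERIV g x :> grad g x"
    using assms by (intro GDERIV_grad) (auto simp: gderiv_def differentiable_def)
  then show ?thesis using assms by (rule GDERIV_unique)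
qed

lemma C1_GDERIV: "C1 g \<Longrightarrow> GDERIV g x :> grad g x"
  by (simp add: C1_def GDERIV_grad)

lemma C1_continuous: "C1 g \<Longrightarrow> continuous_on S g"
  by (metis C1_def continuous_at_imp_continuous_on differentiable_imp_continuous_within)

lemma grad_uminus: "C1 g \<Longrightarrow> grad (\<lambda>x. - g x) = (\<lambda>x. - grad g x)"
  by (intro ext grad_eqI GDERIV_minus C1_GDERIV)

text \<open>The origin is a global minimum. This later makes the improved policy vanish at the
  origin.\<close>

lemma pos_definite_grad_0:
  assumes "C1 g" "pos_definite g"
  shows "grad g 0 = 0"
proof -
  have "g 0 \<le> g y" for y
    using assms(2) by (cases "y = 0") (auto simp: pos_definite_def less_imp_le)
  then have "(\<lambda>h. h \<bullet> grad g 0) = (\<lambda>h. 0)"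
    using C1_GDERIV[OF assms(1), of 0]
    by (intro differential_zero_maxmin[where f=g and x=0 and S=UNIV]) (auto simp: gderiv_def)
  then show ?thesis by (metis inner_eq_zero_iff)
qed

lemma pos_definite_nonneg: "pos_definite g \<Longrightarrow> g x \<ge> 0"
  by (cases "x = 0") (auto simp: pos_definite_def less_imp_le)

text \<open>Boundedness of sublevel sets; the absolute value in \<open>outer_inf\<close> is the
  reason for the condition \<open>0 \<le> g x\<close>.\<close>

lemma radially_unbounded_sublevel:
  assumes "radially_unbounded g"
  obtains R where "\<And>x. g x \<le> B \<Longrightarrow> 0 \<le> g x \<Longrightarrow> norm x \<le> R"
proof -
  have "eventually (\<lambda>\<rho>. outer_inf g \<rho> > B) at_top"
    using assms by (simp add: radially_unbounded_def filterlim_at_top_dense)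
  then obtain \<rho> where \<rho>: "outer_inf g \<rho> > B"
    by (metis eventually_at_top_linorder order_refl)
  have "norm x \<le> \<rho>" if "g x \<le> B" "0 \<le> g x" for x
  proof (rule ccontr)
    assume "\<not> norm x \<le> \<rho>"
    then have "outer_inf g \<rho> \<le> \<bar>g x\<bar>"
      unfolding outer_inf_def by (intro cINF_lower bdd_belowI2[of _ 0]) auto
    then show False using that \<rho> by simp
  qed
  then show ?thesis using that by blast
qed

lemma compact_pos_lower_bound:
  fixes g :: "'a::metric_space \<Rightarrow> real"
  assumes "compact K" "continuous_on K g" "\<And>x. x \<in> K \<Longrightarrow> g x > 0"
  obtains m where "m > 0" "\<And>x. x \<in> K \<Longrightarrow> m \<le> g x"
proof (cases "K = {}")
  case True
  then show ?thesis using that[of 1] by auto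
next
  case False
  then obtain y where "y \<in> K" "\<And>x. x \<in> K \<Longrightarrow> g y \<le> g x"
    using continuous_attains_inf[OF assms(1) _ assms(2)] by blast
  then show ?thesis using that[of "g y"] assms(3) by auto
qed

text \<open>On the compact shell between radius \<open>\<epsilon>\<close> and the bound
  \<open>R\<close> the function has a positive minimum, so small values of \<open>g\<close> along
  \<open>X\<close> force \<open>X\<close> into the small ball.\<close>

lemma pos_definite_tendsto_0:
  fixes X :: "real \<Rightarrow> real ^ 'l"
  assumes g: "pos_definite g" "continuous_on UNIV g"
    and lim: "((\<lambda>t. g (X t)) \<longlongrightarrow> 0) at_top" and bd: "\<And>t. t \<ge> 0 \<Longrightarrow> norm (X t) \<le> R"
  shows "(X \<longlongrightarrow> 0) at_top"
proof (rule tendstoI)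
  fix \<epsilon> :: real assume \<epsilon>: "\<epsilon> > 0"
  let ?K = "cball (0 :: real ^ 'l) R - ball 0 \<epsilon>"
  have "compact ?K" by (intro compact_diff) auto
  moreover have "continuous_on ?K g" using g(2) by (rule continuous_on_subset) auto
  moreover have "g x > 0" if "x \<in> ?K" for x
    using g(1) \<epsilon> that by (cases "x = 0") (auto simp: pos_definite_def)
  ultimately obtain m where m: "m > 0" "\<And>x. x \<in> ?K \<Longrightarrow> m \<le> g x"
    by (rule compact_pos_lower_bound) blast+
  have "eventually (\<lambda>t. g (X t) < m) at_top" using lim m(1) by (rule order_tendstoD)
  then show "eventually (\<lambda>t. dist (X t) 0 < \<epsilon>) at_top"
    using eventually_ge_at_top[of "0::real"]
  proof eventually_elim
    case (elim t)
    then show ?case using m(2)[of "X t"] bd[of t] by (force simp: dist_norm)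
  qed
qed

subsection \<open>Discounted running cost\<close>

text \<open>The running cost is kept abstract: besides closed-loop costs, it is later instantiated
  by the dissipation rate of a Lyapunov function with \<open>\<alpha> = 0\<close>.\<close>

locale controlled = autonomous F for F :: "real ^ 'l \<Rightarrow> real ^ 'l" +
  fixes cc :: "real ^ 'l \<Rightarrow> real" and \<alpha> :: real
  assumes cc_continuous: "continuous_on UNIV cc" and cc_nonneg: "cc x \<ge> 0"
begin

definition rate :: "real ^ 'l \<Rightarrow> real \<Rightarrow> real" where
  "rate x t = exp (- \<alpha> * t) * cc (traj F x t)"

definition acc :: "real ^ 'l \<Rightarrow> real \<Rightarrow> real" where
  "acc x T = integral {0..T} (rate x)"

definition total :: "real ^ 'l \<Rightarrow> ennreal" where
  "total x = (\<integral>\<^sup>+t\<in>{0..}. ennreal (rate x t) \<partial>lborel)"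

lemma rate_nonneg: "rate x t \<ge> 0"
  by (simp add: rate_def cc_nonneg)

lemma rate_continuous:
  assumes "I \<subseteq> {0..}" "\<And>t. t \<in> I \<Longrightarrow> ereal t < t_max F x"
  shows "continuous_on I (rate x)"
  unfolding rate_def
  by (intro continuous_intros continuous_on_compose2[OF cc_continuous]
      solves_on_continuous[OF traj_solves_on] assms) auto

lemma rate_continuous_atMost:
  assumes "ereal T < t_max F x"
  shows "continuous_on {0..T} (rate x)"
  using assms by (intro rate_continuous) (auto intro: le_less_trans[of _ "ereal T"])

lemma acc_nonneg: "acc x T \<ge> 0"
  unfolding acc_def
  \<comment> \<open>The integral of a non-integrable function is 0 by convention, which covers
    horizons beyond the existence interval.\<close>
  by (cases "rate x integrable_on {0..T}")
    (auto intro: Henstock_Kurzweil_Integration.integral_nonneg rate_nonneg simp: not_integrable_integral)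

lemma rate_shift:
  assumes "t_max F x = \<infinity>" "0 \<le> s" "0 \<le> t"
  shows "rate x (s + t) = exp (- \<alpha> * s) * rate (traj F x s) t"
  using assms by (simp add: rate_def traj_add exp_add[symmetric] algebra_simps)

lemma acc_add:
  assumes "t_max F x = \<infinity>" "0 \<le> s" "0 \<le> t"
  shows "acc x (s + t) = acc x s + exp (- \<alpha> * s) * acc (traj F x s) t"
proof -
  have c: "continuous_on {a..b} (rate x)" if "0 \<le> a" for a b
    using assms that by (intro rate_continuous) auto
  have "acc x (s + t) = acc x s + integral {s..s + t} (rate x)"
    unfolding acc_def using assms
    by (intro Henstock_Kurzweil_Integration.integral_combine[symmetric] integrable_continuous_real c) auto
  also have "integral {s..s + t} (rate x) = integral {0..t} (rate x \<circ> (\<lambda>u. u + s))"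
    using integral_shift[of 0 s t "rate x"] c[of s "s + t"] assms by (simp add: add.commute)
  also have "\<dots> = integral {0..t} (\<lambda>u. exp (- \<alpha> * s) * rate (traj F x s) u)"
    using rate_shift[OF assms(1,2)]
    by (intro Henstock_Kurzweil_Integration.integral_cong) (simp add: add.commute)
  finally show ?thesis by (simp add: acc_def)
qed

lemma acc_mono:
  assumes "t_max F x = \<infinity>" "0 \<le> s" "s \<le> t"
  shows "acc x s \<le> acc x t"
  using acc_add[of x s "t - s"] assms acc_nonneg[of "traj F x s" "t - s"] by simp

lemma acc_has_derivative:
  assumes "t_max F x = \<infinity>" "t \<ge> 0"
  shows "(acc x has_vector_derivative rate x t) (at t within {0..})"
  unfolding acc_def using assms
  by (intro integral_has_vector_derivative_atLeast rate_continuous) auto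

lemma nn_integral_rate:
  assumes "ereal T < t_max F x"
  shows "(\<integral>\<^sup>+t\<in>{0..T}. ennreal (rate x t) \<partial>lborel) = ennreal (acc x T)"
  unfolding acc_def using rate_continuous_atMost[OF assms]
  by (intro nn_integral_has_integral_lebesgue' rate_nonneg integrable_integral
      integrable_continuous_real)

lemma rate_measurable:
  assumes "t_max F x = \<infinity>"
  shows "(\<lambda>t. indicator {0..} t *\<^sub>R rate x t) \<in> borel_measurable lborel"
proof -
  have "continuous_on {0..} (rate x)" using assms by (intro rate_continuous) auto
  then show ?thesis
    using borel_measurable_continuous_on_indicator[of "{0::real..}" "rate x"] by simp
qed

text \<open>Monotone convergence along the multiples of \<open>h\<close>. Sampled bounds suffice,
  which matters when the Bellman equation is known only for the horizon
  \<open>\<eta>\<close>.\<close>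

lemma total_le:
  assumes "t_max F x = \<infinity>" "h > 0" and bd: "\<And>n. acc x (real n * h) \<le> B"
  shows "total x \<le> ennreal B"
proof -
  let ?f = "\<lambda>n t. ennreal (rate x t) * indicator {0..real n * h} t"
  have "(\<lambda>n. \<integral>\<^sup>+t. ?f n t \<partial>lborel) \<longlonglongrightarrow> (\<integral>\<^sup>+t. ennreal (rate x t) * indicator {0..} t \<partial>lborel)"
  proof (rule nn_integral_LIMSEQ)
    show "incseq ?f"
      using assms(2)
      by (auto simp: incseq_def le_fun_def indicator_def intro: order_trans mult_right_mono)
    fix n
    have "(\<lambda>t. ennreal (indicator {0..} t *\<^sub>R rate x t) * indicator {0..real n * h} t)
        \<in> borel_measurable lborel"
      by (intro borel_measurable_times_ennreal measurable_compose[OF rate_measurable]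
          borel_measurable_indicator) (auto simp: assms)
    also have "(\<lambda>t. ennreal (indicator {0..} t *\<^sub>R rate x t) * indicator {0..real n * h} t) = ?f n"
      by (auto simp: indicator_def)
    finally show "?f n \<in> borel_measurable lborel" .
  next
    fix t :: real
    have "eventually (\<lambda>n. ?f n t = ennreal (rate x t) * indicator {0..} t) sequentially"
    proof -
      obtain N :: nat where N: "t / h \<le> real N" using real_arch_simple by blast
      show ?thesis
      proof (rule eventually_sequentiallyI)
        fix n assume "N \<le> n"
        then have "t / h \<le> real n" using N by simp
        then have "t \<le> real n * h" using assms(2) by (simp add: field_simps)
        then show "?f n t = ennreal (rate x t) * indicator {0..} t" by (auto simp: indicator_def)
      qed
    qed
    then show "(\<lambda>n. ?f n t) \<longlonglongrightarrow> ennreal (rate x t) * indicator {0..} t"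
      by (rule tendsto_eventually)
  qed
  moreover have "(\<integral>\<^sup>+t. ?f n t \<partial>lborel) \<le> ennreal B" for n
    using nn_integral_rate[of "real n * h" x] bd[of n] assms(1) by (simp add: ennreal_leI)
  ultimately show ?thesis unfolding total_def by (intro LIMSEQ_le_const2) auto
qed

lemma acc_tendsto_total:
  assumes "t_max F x = \<infinity>" "total x < \<infinity>"
  shows "(acc x \<longlongrightarrow> enn2real (total x)) at_top"
proof -
  have tot: "(\<integral>\<^sup>+t. ennreal (indicator {0..} t *\<^sub>R rate x t) \<partial>lborel) = total x"
    unfolding total_def by (intro nn_integral_cong) (auto simp: indicator_def)
  have int: "set_integrable lborel {0..} (rate x)"
    unfolding set_integrable_def
    using rate_measurable[OF assms(1)] tot assms(2) rate_nonneg
    by (intro integrableI_nonneg) auto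
  have "(LINT t:{0..}|lborel. rate x t) = enn2real (total x)"
    unfolding set_lebesgue_integral_def tot[symmetric] using rate_measurable[OF assms(1)] rate_nonneg
    by (intro integral_eq_nn_integral) auto
  moreover have "(LINT t:{0..T}|lborel. rate x t) = acc x T" for T
    unfolding acc_def using int
    by (intro set_borel_integral_eq_integral(2) set_integrable_subset[OF int]) auto
  moreover have "((\<lambda>T. LINT t:{0..T}|lborel. rate x t) \<longlongrightarrow> (LINT t:{0..}|lborel. rate x t)) at_top"
    by (intro tendsto_set_lebesgue_integral_at_top int) auto
  ultimately show ?thesis by simp
qed

text \<open>The limit \<open>T \<rightarrow> \<infinity>\<close> in \<open>acc_add\<close> at time
  \<open>t + T\<close>.\<close>

lemma total_dynamic_programming:
  assumes inf: "\<And>x. t_max F x = \<infinity>" and fin: "\<And>x. total x < \<infinity>" and t: "t \<ge> 0"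
  shows "enn2real (total x) = acc x t + exp (- \<alpha> * t) * enn2real (total (traj F x t))"
proof (rule tendsto_unique[of at_top])
  have "filterlim (\<lambda>T. t + T) at_top (at_top :: real filter)"
    by (rule filterlim_tendsto_add_at_top[OF tendsto_const filterlim_ident])
  from filterlim_compose[OF acc_tendsto_total[OF inf fin] this]
  show "((\<lambda>T. acc x (t + T)) \<longlongrightarrow> enn2real (total x)) at_top" .
  have "((\<lambda>T. acc x t + exp (- \<alpha> * t) * acc (traj F x t) T) \<longlongrightarrow>
      acc x t + exp (- \<alpha> * t) * enn2real (total (traj F x t))) at_top"
    by (intro tendsto_intros acc_tendsto_total inf fin)
  then show "((\<lambda>T. acc x (t + T)) \<longlongrightarrow>
      acc x t + exp (- \<alpha> * t) * enn2real (total (traj F x t))) at_top"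
    by (rule Lim_transform_eventually)
      (auto intro!: eventually_mono[OF eventually_ge_at_top[of 0]] simp: acc_add inf t)
qed simp

text \<open>The balance first bounds the total by \<open>J x\<close>, hence makes it finite; then
  \<open>acc\<close> converges to it, in particular along the samples, where the remainder
  vanishes.\<close>

lemma total_eqI:
  assumes inf: "t_max F x = \<infinity>" and h: "h > 0" and nonneg: "\<And>y. J y \<ge> 0"
    and eq: "\<And>n. J x = acc x (real n * h) + exp (- \<alpha> * (real n * h)) * J (traj F x (real n * h))"
    and lim: "(\<lambda>n. exp (- \<alpha> * (real n * h)) * J (traj F x (real n * h))) \<longlonglongrightarrow> 0"
  shows "total x = ennreal (J x)"
proof -
  have le: "total x \<le> ennreal (J x)"
    using eq nonneg by (intro total_le[OF inf h]) (smt (verit) exp_gt_zero mult_nonneg_nonneg)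
  then have fin: "total x < \<infinity>" by (auto intro: le_less_trans)
  have "filterlim (\<lambda>n. real n * h) at_top sequentially"
    using filterlim_real_sequentially h by (simp add: filterlim_at_top_mult_tendsto_pos[OF tendsto_const])
  from filterlim_compose[OF acc_tendsto_total[OF inf fin] this]
  have "(\<lambda>n. acc x (real n * h) + exp (- \<alpha> * (real n * h)) * J (traj F x (real n * h)))
      \<longlonglongrightarrow> enn2real (total x) + 0"
    by (intro tendsto_add lim)
  then have "J x = enn2real (total x)"
    using eq by (simp flip: eq add: LIMSEQ_const_iff)
  then show ?thesis using fin by simp
qed

subsection \<open>Differential Bellman inequalities along trajectories\<close>

lemma value_along_has_integral:
  assumes J: "C1 J" and t: "0 \<le> t" "ereal t < t_max F x"
  shows "((\<lambda>s. exp (- \<alpha> * s) *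
      (grad J (traj F x s) \<bullet> F (traj F x s) - \<alpha> * J (traj F x s))) has_integral
     (exp (- \<alpha> * t) * J (traj F x t) - J x)) {0..t}"
proof -
  have sol: "solves_on F x {0..t} (traj F x)"
    using t by (intro traj_solves_on) (auto intro: le_less_trans[of _ "ereal t"])
  have "((\<lambda>s. exp (- \<alpha> * s) *
      (grad J (traj F x s) \<bullet> F (traj F x s) - \<alpha> * J (traj F x s))) has_integral
     (exp (- \<alpha> * t) * J (traj F x t) - exp (- \<alpha> * 0) * J (traj F x 0))) {0..t}"
  proof (rule fundamental_theorem_of_calculus)
    fix s assume s: "s \<in> {0..t}"
    have dJ: "((\<lambda>s. J (traj F x s)) has_derivative
        (\<lambda>h. h * (grad J (traj F x s) \<bullet> F (traj F x s)))) (at s within {0..t})"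
      using has_derivative_compose[OF solves_onD(2)[OF sol s, unfolded has_vector_derivative_def]
          C1_GDERIV[OF J, unfolded gderiv_def]]
      by (simp add: inner_commute)
    show "((\<lambda>s. exp (- \<alpha> * s) * J (traj F x s)) has_vector_derivative
      exp (- \<alpha> * s) * (grad J (traj F x s) \<bullet> F (traj F x s) - \<alpha> * J (traj F x s)))
      (at s within {0..t})"
      unfolding has_vector_derivative_def
      by (rule derivative_eq_intros dJ refl)+ (simp add: algebra_simps)
  qed (rule t)
  then show ?thesis by simp
qed

lemma value_decrease:
  assumes J: "C1 J" and le: "\<And>y. grad J y \<bullet> F y \<le> \<alpha> * J y - cc y"
    and t: "0 \<le> t" "ereal t < t_max F x"
  shows "acc x t + exp (- \<alpha> * t) * J (traj F x t) \<le> J x"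
proof -
  have "rate x integrable_on {0..t}"
    using rate_continuous_atMost[OF t(2)] by (rule integrable_continuous_real)
  then have "((\<lambda>s. - rate x s) has_integral - acc x t) {0..t}"
    unfolding acc_def by (intro has_integral_neg integrable_integral)
  with value_along_has_integral[OF J t] have "exp (- \<alpha> * t) * J (traj F x t) - J x \<le> - acc x t"
  proof (rule has_integral_le)
    fix s
    have "exp (- \<alpha> * s) * (grad J (traj F x s) \<bullet> F (traj F x s) - \<alpha> * J (traj F x s))
        \<le> exp (- \<alpha> * s) * (- cc (traj F x s))"
      using le[of "traj F x s"] by (intro mult_left_mono) auto
    then show "exp (- \<alpha> * s) * (grad J (traj F x s) \<bullet> F (traj F x s) - \<alpha> * J (traj F x s))
        \<le> - rate x s" by (simp add: rate_def)
  qed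
  then show ?thesis by simp
qed

lemma value_balance:
  assumes J: "C1 J" and eq: "\<And>y. grad J y \<bullet> F y = \<alpha> * J y - cc y"
    and t: "0 \<le> t" "ereal t < t_max F x"
  shows "J x = acc x t + exp (- \<alpha> * t) * J (traj F x t)"
proof -
  have "rate x integrable_on {0..t}"
    using rate_continuous_atMost[OF t(2)] by (rule integrable_continuous_real)
  then have "((\<lambda>s. - rate x s) has_integral - acc x t) {0..t}"
    unfolding acc_def by (intro has_integral_neg integrable_integral)
  moreover have "((\<lambda>s. - rate x s) has_integral (exp (- \<alpha> * t) * J (traj F x t) - J x)) {0..t}"
    using value_along_has_integral[OF J t] by (simp add: eq rate_def)
  ultimately have "- acc x t = exp (- \<alpha> * t) * J (traj F x t) - J x"
    by (rule has_integral_unique)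
  then show ?thesis by simp
qed

text \<open>Up to a finite time \<open>T\<close>, \<open>J\<close> grows at most by the factor
  \<open>exp (\<alpha> * T)\<close>, so the trajectory stays in a bounded sublevel set.\<close>

lemma global_existence:
  assumes J: "C1 J" "pos_definite J" "radially_unbounded J" and \<alpha>: "\<alpha> \<ge> 0"
    and le: "\<And>y. grad J y \<bullet> F y \<le> \<alpha> * J y - cc y"
  shows "t_max F x = \<infinity>"
proof (rule t_max_eq_infinityI)
  fix T assume T: "T > 0" "t_max F x = ereal T"
  obtain R where R: "\<And>y. J y \<le> exp (\<alpha> * T) * J x \<Longrightarrow> 0 \<le> J y \<Longrightarrow> norm y \<le> R"
    using radially_unbounded_sublevel[OF J(3)] by blast
  have "norm (traj F x t) \<le> R" if t: "0 \<le> t" "t < T" for t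
  proof (rule R)
    have "exp (- \<alpha> * t) * J (traj F x t) \<le> J x"
      using value_decrease[OF J(1) le, of t x] t T acc_nonneg[of x t] by simp
    then have "J (traj F x t) \<le> exp (\<alpha> * t) * J x"
      by (simp add: exp_minus field_simps)
    also have "\<dots> \<le> exp (\<alpha> * T) * J x"
      using \<alpha> t pos_definite_nonneg[OF J(2)] by (intro mult_right_mono) (auto intro: mult_left_mono)
    finally show "J (traj F x t) \<le> exp (\<alpha> * T) * J x" .
  qed (rule pos_definite_nonneg[OF J(2)])
  then show "\<exists>R. \<forall>t. 0 \<le> t \<and> t < T \<longrightarrow> norm (traj F x t) \<le> R" by blast
qed

text \<open>Stated with an inequality so that it applies to the improved policy, for which
  \<open>J\<close> is only a supersolution.\<close>

lemma total_le_value: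
  assumes J: "C1 J" "pos_definite J" "radially_unbounded J" and \<alpha>: "\<alpha> \<ge> 0"
    and le: "\<And>y. grad J y \<bullet> F y \<le> \<alpha> * J y - cc y"
  shows "total x \<le> ennreal (J x)"
proof (rule total_le[where h=1])
  show inf: "t_max F x = \<infinity>" by (rule global_existence[OF assms])
  fix n :: nat
  have "0 \<le> exp (- \<alpha> * (real n * 1)) * J (traj F x (real n * 1))"
    using pos_definite_nonneg[OF J(2)] by simp
  then show "acc x (real n * 1) \<le> J x"
    using value_decrease[OF J(1) le, of "real n * 1" x] inf by simp
qed simp

end

subsection \<open>Lyapunov's theorem\<close>

text \<open>With the dissipation rate \<open>W\<close> as an undiscounted running cost,
  \<open>J\<close> solves the differential Bellman equation. The balance between \<open>J\<close>
  and the accumulated dissipation then replaces separate arguments on the derivative of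
  \<open>J\<close>.\<close>

lemma (in autonomous) lyapunov_global_asymp_stable:
  assumes J: "C1 J" "pos_definite J" "radially_unbounded J" and F0: "F 0 = 0"
    and neg: "\<And>y. y \<noteq> 0 \<Longrightarrow> grad J y \<bullet> F y < 0"
  shows "globally_asymp_stable F"
proof -
  define W where "W y = - (grad J y \<bullet> F y)" for y
  have W_pos: "W y > 0" if "y \<noteq> 0" for y using neg[OF that] by (simp add: W_def)
  have W_cont: "continuous_on UNIV W"
    unfolding W_def using J(1) loc_lipschitz_on_continuous[OF lip]
    by (intro continuous_intros) (auto simp: C1_def)
  interpret controlled F W 0
  proof
    fix x show "W x \<ge> 0" using W_pos[of x] by (cases "x = 0") (auto simp: W_def F0)
  qed (rule W_cont)
  have inf: "t_max F x = \<infinity>" for x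
    by (rule global_existence[OF J]) (simp_all add: W_def)
  have bal: "J x = acc x t + J (traj F x t)" if "t \<ge> 0" for x t
    using value_balance[OF J(1), of t x] that inf by (simp add: W_def)
  have J_le: "J (traj F x t) \<le> J x" if "t \<ge> 0" for x t
    using bal[OF that, of x] acc_nonneg[of x t] by simp
  have J_pos: "J y > 0" if "y \<noteq> 0" for y using J(2) that by (simp add: pos_definite_def)
  have stable: "lyapunov_stable F"
    unfolding lyapunov_stable_def
  proof (intro allI impI)
    fix \<epsilon> :: real assume \<epsilon>: "\<epsilon> > 0"
    \<comment> \<open>\<open>J\<close> is at least \<open>m\<close> on the sphere. A trajectory that
      starts inside it with \<open>J\<close> below \<open>m\<close> cannot cross it, since
      \<open>J\<close> does not increase.\<close>
    have "J y > 0" if "y \<in> sphere 0 \<epsilon>" for y using that \<epsilon> by (intro J_pos) auto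
    then obtain m where m: "m > 0" "\<And>y. y \<in> sphere 0 \<epsilon> \<Longrightarrow> m \<le> J y"
      using compact_pos_lower_bound[OF compact_sphere C1_continuous[OF J(1)], of 0 \<epsilon>] by metis
    have "isCont J 0" using J(1) by (simp add: C1_def differentiable_imp_continuous_within)
    then obtain d where d: "d > 0" "\<And>y. norm y < d \<Longrightarrow> dist (J y) (J 0) < m"
      unfolding continuous_at_eps_delta dist_norm using m(1) by (metis diff_zero)
    have dm: "J y < m" if "norm y < d" for y
      using d(2)[OF that] J(2) by (simp add: pos_definite_def dist_real_def)
    show "\<exists>\<delta>>0. \<forall>x. norm x < \<delta> \<longrightarrow> (\<forall>t\<ge>0. ereal t < t_max F x \<longrightarrow> norm (traj F x t) < \<epsilon>)"
    proof (intro exI[of _ "min d \<epsilon>"] conjI allI impI)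
      fix x :: "real ^ 'l" and t assume x: "norm x < min d \<epsilon>" and t: "0 \<le> (t::real)"
      show "norm (traj F x t) < \<epsilon>"
      proof (rule ccontr)
        assume "\<not> norm (traj F x t) < \<epsilon>"
        moreover have "continuous_on {0..t} (\<lambda>s. norm (traj F x s))"
          by (intro continuous_intros continuous_on_subset[OF traj_continuous[OF inf]]) auto
        ultimately obtain s where "0 \<le> s" "norm (traj F x s) = \<epsilon>"
          using IVT'[of "\<lambda>s. norm (traj F x s)" 0 \<epsilon> t] x t by auto
        then show False using m(2)[of "traj F x s"] J_le[of s x] dm[of x] x by simp
      qed
    qed (use d \<epsilon> in auto)
  qed
  have "(traj F x \<longlongrightarrow> 0) at_top" for x
  proof -
    obtain R where R: "\<And>y. J y \<le> J x \<Longrightarrow> 0 \<le> J y \<Longrightarrow> norm y \<le> R"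
      using radially_unbounded_sublevel[OF J(3)] by blast
    have bd: "norm (traj F x t) \<le> R" if "t \<ge> 0" for t
      using J_le[OF that] pos_definite_nonneg[OF J(2)] by (rule R)
    \<comment> \<open>Otherwise the trajectory remains in a compact set away from the origin, where
      the dissipation has a positive lower bound, and the accumulated dissipation grows
      linearly.\<close>
    have small: "\<exists>t\<ge>0. J (traj F x t) < e" if e: "e > 0" for e
    proof (rule ccontr)
      assume "\<not> ?thesis"
      then have ge: "J (traj F x t) \<ge> e" if "t \<ge> 0" for t using that by force
      let ?K = "cball 0 R \<inter> {y. e \<le> J y}"
      have "closed {y. e \<le> J y}"
        by (intro closed_Collect_le C1_continuous[OF J(1)] continuous_intros)
      then have "compact ?K" by (intro compact_Int_closed) auto
      moreover have "continuous_on ?K W" using W_cont by (rule continuous_on_subset) auto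
      moreover have "W y > 0" if "y \<in> ?K" for y
        using that e J(2) by (intro W_pos) (auto simp: pos_definite_def)
      ultimately obtain m where m: "m > 0" "\<And>y. y \<in> ?K \<Longrightarrow> m \<le> W y"
        by (rule compact_pos_lower_bound) blast+
      have lower: "m * t \<le> acc x t" if t: "t \<ge> 0" for t
      proof -
        have "integral {0..t} (\<lambda>_. m) \<le> integral {0..t} (rate x)"
        proof (rule integral_le)
          show "rate x integrable_on {0..t}"
            by (intro integrable_continuous_real rate_continuous_atMost) (simp add: inf)
          fix s assume "s \<in> {0..t}"
          then show "m \<le> rate x s" using m(2)[of "traj F x s"] bd[of s] ge[of s]
            by (simp add: rate_def)
        qed auto
        then show ?thesis using t by (simp add: acc_def mult.commute)
      qed
      \<comment> \<open>At this time the linear lower bound equals \<open>J x + 1\<close>, while the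
        balance allows at most \<open>J x\<close>.\<close>
      have "m * ((J x + 1) / m) \<le> J x"
        using lower[of "(J x + 1) / m"] bal[of "(J x + 1) / m" x] m(1)
          pos_definite_nonneg[OF J(2)] order_trans by (smt (verit) divide_nonneg_pos)
      then show False using m(1) by simp
    qed
    have "((\<lambda>t. J (traj F x t)) \<longlongrightarrow> 0) at_top"
    proof (rule tendstoI)
      fix e :: real assume "e > 0"
      then obtain T where T: "T \<ge> 0" "J (traj F x T) < e" using small by blast
      have "dist (J (traj F x t)) 0 < e" if "t \<ge> T" for t
        using bal[of t x] bal[of T x] acc_mono[OF inf T(1) that, of x] T that
          pos_definite_nonneg[OF J(2), of "traj F x t"] by (simp add: dist_real_def)
      then show "\<forall>\<^sub>F t in at_top. dist (J (traj F x t)) 0 < e"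
        by (auto simp: eventually_at_top_linorder)
    qed
    then show ?thesis
      by (rule pos_definite_tendsto_0[OF J(2) C1_continuous[OF J(1)]]) (rule bd)
  qed
  then show ?thesis using stable inf by (simp add: globally_asymp_stable_def globally_attractive_def)
qed

subsection \<open>Evaluation of a policy\<close>

text \<open>Monotonicity gives \<open>t * g t \<le> B\<close>; beyond the threshold used below,
  \<open>t * e\<close> exceeds the absolute value of \<open>B\<close>.\<close>

lemma nonneg_integral_bounded_decreasing_tendsto_0:
  fixes g :: "real \<Rightarrow> real"
  assumes dec: "\<And>s t. 0 \<le> s \<Longrightarrow> s \<le> t \<Longrightarrow> g t \<le> g s" and nonneg: "\<And>t. 0 \<le> t \<Longrightarrow> 0 \<le> g t"
    and bd: "\<And>t. 0 \<le> t \<Longrightarrow> g integrable_on {0..t} \<and> integral {0..t} g \<le> B"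
  shows "(g \<longlongrightarrow> 0) at_top"
proof (rule tendstoI)
  fix e :: real assume e: "e > 0"
  have gt: "t * g t \<le> B" if "t \<ge> 0" for t
  proof -
    have "integral {0..t} (\<lambda>_. g t) \<le> integral {0..t} g"
      using bd[OF that] dec by (intro integral_le) auto
    then show ?thesis using bd[OF that] that by simp
  qed
  have "dist (g t) 0 < e" if t: "t \<ge> \<bar>B\<bar> / e + 1" for t
  proof -
    have t0: "t > 0" "\<bar>B\<bar> < t * e"
      using t e by (smt (verit) divide_nonneg_pos, simp add: field_simps)
    then have "t * g t < t * e" using gt[of t] by linarith
    then have "g t < e" using t0(1) by (simp only: mult_less_cancel_left_pos)
    then show ?thesis using t0 nonneg[of t] by (simp add: dist_real_def)
  qed
  then show "\<forall>\<^sub>F t in at_top. dist (g t) 0 < e" by (auto simp: eventually_at_top_linorder)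
qed

lemma (in controlled) integral_scaled_value_le:
  assumes inf: "t_max F x = \<infinity>" and J: "continuous_on UNIV J" and t: "t \<ge> 0"
    and \<kappa>: "\<kappa> > 0" "\<And>y. \<kappa> * J y \<le> cc y"
  shows "(\<lambda>s. exp (- \<alpha> * s) * J (traj F x s)) integrable_on {0..t}"
    "integral {0..t} (\<lambda>s. exp (- \<alpha> * s) * J (traj F x s)) \<le> acc x t / \<kappa>"
proof -
  have "continuous_on {0..t} (\<lambda>s. exp (- \<alpha> * s) * J (traj F x s))"
    by (intro continuous_intros continuous_on_compose2[OF J]
        continuous_on_subset[OF traj_continuous[OF inf]]) auto
  then show int: "(\<lambda>s. exp (- \<alpha> * s) * J (traj F x s)) integrable_on {0..t}"
    by (rule integrable_continuous_real)
  have "integral {0..t} (\<lambda>s. exp (- \<alpha> * s) * J (traj F x s)) \<le> integral {0..t} (\<lambda>s. rate x s / \<kappa>)"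
  proof (rule integral_le[OF int])
    show "(\<lambda>s. rate x s / \<kappa>) integrable_on {0..t}"
      by (intro integrable_continuous_real continuous_intros rate_continuous_atMost)
        (use inf \<kappa> in auto)
    fix s
    have "J (traj F x s) \<le> cc (traj F x s) / \<kappa>"
      using \<kappa> by (simp add: pos_le_divide_eq mult.commute)
    then show "exp (- \<alpha> * s) * J (traj F x s) \<le> rate x s / \<kappa>"
      using mult_left_mono[of "J (traj F x s)" "cc (traj F x s) / \<kappa>" "exp (- \<alpha> * s)"]
      by (simp add: rate_def)
  qed
  then show "integral {0..t} (\<lambda>s. exp (- \<alpha> * s) * J (traj F x s)) \<le> acc x t / \<kappa>"
    by (simp add: acc_def)
qed

lemma (in controlled) diff_bellman_total_eq:
  assumes J: "C1 J" "pos_definite J" "radially_unbounded J" and \<alpha>: "\<alpha> \<ge> 0"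
    and eq: "\<And>y. grad J y \<bullet> F y = \<alpha> * J y - cc y"
    and C: "globally_attractive F \<or> (\<exists>\<kappa>>0. \<forall>y. \<kappa> * J y \<le> cc y)"
  shows "total x = ennreal (J x)"
proof -
  have inf: "t_max F y = \<infinity>" for y using global_existence[OF J \<alpha>] eq by simp
  have bal: "J y = acc y t + exp (- \<alpha> * t) * J (traj F y t)" if "t \<ge> 0" for y t
    by (rule value_balance[OF J(1) eq that]) (simp add: inf)
  have nonneg: "J y \<ge> 0" for y using J(2) by (rule pos_definite_nonneg)
  let ?g = "\<lambda>t. exp (- \<alpha> * t) * J (traj F x t)"
  have "(?g \<longlongrightarrow> 0) at_top"
    using C
  proof
    assume "globally_attractive F"
    then have "(traj F x \<longlongrightarrow> 0) at_top" by (simp add: globally_attractive_def)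
    then have "((\<lambda>t. J (traj F x t)) \<longlongrightarrow> J 0) at_top"
      using J(1) by (intro isCont_tendsto_compose[of _ J])
        (simp_all add: C1_def differentiable_imp_continuous_within)
    then have lim: "((\<lambda>t. J (traj F x t)) \<longlongrightarrow> 0) at_top" using J(2) by (simp add: pos_definite_def)
    show ?thesis
    proof (rule tendsto_sandwich[OF _ _ tendsto_const lim])
      show "\<forall>\<^sub>F t in at_top. ?g t \<le> J (traj F x t)"
        using \<alpha> nonneg by (intro eventually_mono[OF eventually_ge_at_top[of 0]])
          (simp add: mult_left_le_one_le)
    qed (simp add: nonneg)
  next
    assume "\<exists>\<kappa>>0. \<forall>y. \<kappa> * J y \<le> cc y"
    then obtain \<kappa> where \<kappa>: "\<kappa> > 0" "\<And>y. \<kappa> * J y \<le> cc y" by blast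
    show ?thesis
    proof (rule nonneg_integral_bounded_decreasing_tendsto_0[where B="J x / \<kappa>"])
      \<comment> \<open>By the balance, \<open>?g t\<close> is \<open>J x\<close> minus the
        nondecreasing \<open>acc x t\<close>.\<close>
      show "?g t \<le> ?g s" if "0 \<le> s" "s \<le> t" for s t
        using bal[of s x] bal[of t x] acc_mono[OF inf that, of x] that by linarith
      show "?g integrable_on {0..t} \<and> integral {0..t} ?g \<le> J x / \<kappa>" if t: "0 \<le> t" for t
      proof -
        have "acc x t \<le> J x" using bal[OF t, of x] nonneg[of "traj F x t"] by simp
        then have "acc x t / \<kappa> \<le> J x / \<kappa>" using \<kappa>(1) by (simp add: divide_right_mono)
        then show ?thesis
          using integral_scaled_value_le[OF inf C1_continuous[OF J(1)] t \<kappa>, of x]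
          by (meson order_trans)
      qed
    qed (simp add: nonneg)
  qed
  from filterlim_compose[OF this filterlim_real_sequentially]
  show ?thesis
    by (intro total_eqI[where h=1] bal inf nonneg) auto
qed

subsection \<open>Composition of locally Lipschitz maps\<close>

lemma loc_lipschitz_onE:
  assumes "loc_lipschitz_on S g" "x \<in> S"
  obtains u L where "u > 0" "L-lipschitz_on (cball x u \<inter> S) g"
proof -
  obtain u L where "u > 0" "\<And>s. s \<in> cball (0::real) u \<inter> UNIV \<Longrightarrow> L-lipschitz_on (cball x u \<inter> S) g"
    using assms unfolding loc_lipschitz_on_def by (metis local_lipschitzE UNIV_I)
  then show ?thesis using that[of u L] by (metis Int_UNIV_right centre_in_cball less_imp_le)
qed

text \<open>Used both for the closed-loop field and for the improved policy as a composition with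
  the gradient.\<close>

lemma loc_lipschitz_on_compose:
  assumes g: "loc_lipschitz_on S g" and f: "loc_lipschitz_on T f" and sub: "g ` S \<subseteq> T"
  shows "loc_lipschitz_on S (\<lambda>x. f (g x))"
  unfolding loc_lipschitz_on_def
proof (rule local_lipschitzI)
  fix t :: real and x assume x: "x \<in> S"
  obtain u L where u: "u > 0" "L-lipschitz_on (cball x u \<inter> S) g"
    using g x by (rule loc_lipschitz_onE)
  obtain w M where w: "w > 0" "M-lipschitz_on (cball (g x) w \<inter> T) f"
    using x sub by (blast intro: loc_lipschitz_onE[OF f])
  have "continuous_on S g" using g by (rule loc_lipschitz_on_continuous)
  then obtain d where d: "d > 0" "\<And>y. y \<in> S \<Longrightarrow> dist y x < d \<Longrightarrow> dist (g y) (g x) < w"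
    using x w(1) unfolding continuous_on_iff by metis
  \<comment> \<open>Halving \<open>d\<close> places the closed ball inside the open ball supplied by
    continuity.\<close>
  define r where "r = min u (d / 2)"
  have "r > 0" using u d by (simp add: r_def)
  moreover have "(M * L)-lipschitz_on (cball x r \<inter> S) (\<lambda>x. f (g x))"
  proof (rule lipschitz_on_compose2[where f=g and g=f])
    show "L-lipschitz_on (cball x r \<inter> S) g"
      using u(2) by (rule lipschitz_on_subset) (auto simp: r_def)
    show "M-lipschitz_on (g ` (cball x r \<inter> S)) f"
    proof (rule lipschitz_on_subset[OF w(2)], clarify)
      fix y assume y: "y \<in> cball x r" "y \<in> S"
      then have "dist y x < d" using d(1) by (simp add: r_def dist_commute)
      then have "dist (g y) (g x) < w" using d(2) y by blast
      then show "g y \<in> cball (g x) w \<inter> T" using y sub by (auto simp: dist_commute)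
    qed
  qed
  ultimately show "\<exists>u>0. \<exists>L. \<forall>t\<in>cball t u \<inter> UNIV. L-lipschitz_on (cball x u \<inter> S) (\<lambda>x. f (g x))"
    by blast
qed

text \<open>Feedback enters through the graph map, since the dynamics and \<open>ustar\<close> are
  Lipschitz jointly in both arguments.\<close>

lemma loc_lipschitz_on_graph:
  assumes "loc_lipschitz_on S g"
  shows "loc_lipschitz_on S (\<lambda>x. (x, g x))"
  using assms unfolding loc_lipschitz_on_def
  by (intro local_lipschitz_PairI local_lipschitzI[of UNIV S "\<lambda>_ x. x"])
    (auto intro!: exI[of _ 1] lipschitz_intros)

subsection \<open>Integral Bellman equations\<close>

context controlled
begin

lemma integral_bellman_iterate:
  assumes \<eta>: "\<eta> > 0" and inf: "\<And>x. t_max F x = \<infinity>"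
    and eq: "\<And>y. J y = acc y \<eta> + exp (- \<alpha> * \<eta>) * J (traj F y \<eta>)"
  shows "J x = acc x (real n * \<eta>) + exp (- \<alpha> * (real n * \<eta>)) * J (traj F x (real n * \<eta>))"
proof (induction n)
  case 0
  show ?case by (simp add: acc_def)
next
  case (Suc n)
  let ?t = "real n * \<eta>"
  have t: "?t \<ge> 0" using \<eta> by simp
  have Suc_t: "real (Suc n) * \<eta> = ?t + \<eta>" by (simp add: algebra_simps)
  have "J x = acc x ?t + exp (- \<alpha> * ?t) *
      (acc (traj F x ?t) \<eta> + exp (- \<alpha> * \<eta>) * J (traj F (traj F x ?t) \<eta>))"
    using Suc.IH unfolding eq[of "traj F x ?t", symmetric] .
  also have "\<dots> = acc x (?t + \<eta>) + exp (- \<alpha> * ?t) * exp (- \<alpha> * \<eta>) * J (traj F x (?t + \<eta>))"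
    unfolding acc_add[OF inf t less_imp_le[OF \<eta>]] traj_add[OF inf t less_imp_le[OF \<eta>]]
    by (simp add: distrib_left mult.assoc)
  also have "exp (- \<alpha> * ?t) * exp (- \<alpha> * \<eta>) = exp (- \<alpha> * (?t + \<eta>))"
    by (simp add: exp_add[symmetric] distrib_left)
  finally show ?case unfolding Suc_t .
qed

text \<open>The gap \<open>D\<close> between a solution of the integral Bellman equation and the cost value has
  \<open>exp (- \<alpha> t) D (X t)\<close> periodic in \<open>t\<close>, so integrability over the half-line forces \<open>D = 0\<close>.\<close>

lemma periodic_discounted_eq_0:
  assumes \<eta>: "\<eta> > 0" and inf: "\<And>x. t_max F x = \<infinity>"
    and D: "continuous_on UNIV D" "\<And>y. D y \<ge> 0"
    and per: "\<And>y. D y = exp (- \<alpha> * \<eta>) * D (traj F y \<eta>)"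
    and bd: "\<And>n. integral {0..real n * \<eta>} (\<lambda>t. exp (- \<alpha> * t) * D (traj F x t)) \<le> B"
  shows "D x = 0"
proof -
  define d where "d t = exp (- \<alpha> * t) * D (traj F x t)" for t
  have cont: "continuous_on {a..b} d" if "0 \<le> a" for a b
    unfolding d_def using that
    by (intro continuous_intros continuous_on_compose2[OF D(1)]
        continuous_on_subset[OF traj_continuous[OF inf]]) auto
  have d_per: "d (t + \<eta>) = d t" if "t \<ge> 0" for t
  proof -
    have "d (t + \<eta>) = exp (- \<alpha> * t) * (exp (- \<alpha> * \<eta>) * D (traj F (traj F x t) \<eta>))"
      using \<eta> that
      by (simp add: d_def traj_add inf mult.assoc[symmetric] exp_add[symmetric] distrib_left)
    then show ?thesis by (simp only: per[of "traj F x t", symmetric] d_def)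
  qed
  have d_per_n: "d (t + real n * \<eta>) = d t" if "t \<ge> 0" for t n
  proof (induction n)
    case (Suc n)
    have "t + real (Suc n) * \<eta> = (t + real n * \<eta>) + \<eta>" by (simp add: algebra_simps)
    then show ?case using d_per[of "t + real n * \<eta>"] Suc that \<eta> by (simp add: add.assoc)
  qed simp
  \<comment> \<open>Over \<open>n\<close> periods the integral is \<open>n\<close> times that over
    one period, so the uniform bound \<open>B\<close> forces the latter to be 0.\<close>
  have int_n: "integral {0..real n * \<eta>} d = real n * integral {0..\<eta>} d" for n
  proof (induction n)
    case (Suc n)
    let ?t = "real n * \<eta>"
    have t: "?t \<ge> 0" using \<eta> by simp
    have "integral {0..?t + \<eta>} d = integral {0..?t} d + integral {?t..?t + \<eta>} d"
      using t \<eta>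
      by (intro Henstock_Kurzweil_Integration.integral_combine[symmetric]
          integrable_continuous_real cont) auto
    also have "integral {?t..?t + \<eta>} d = integral {0..\<eta>} (d \<circ> (\<lambda>u. u + ?t))"
      using integral_shift[of 0 ?t \<eta> d] cont[OF t, of "?t + \<eta>"] by (simp add: add.commute)
    also have "\<dots> = integral {0..\<eta>} d"
      by (intro Henstock_Kurzweil_Integration.integral_cong) (simp add: d_per_n)
    finally show ?case using Suc by (simp add: algebra_simps)
  qed simp
  have d_nonneg: "d t \<ge> 0" for t by (simp add: d_def D)
  have "integral {0..\<eta>} d = 0"
  proof (rule ccontr)
    assume "integral {0..\<eta>} d \<noteq> 0"
    moreover have "integral {0..\<eta>} d \<ge> 0"
      by (intro Henstock_Kurzweil_Integration.integral_nonneg integrable_continuous_real cont d_nonneg) simp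
    ultimately have pos: "integral {0..\<eta>} d > 0" by simp
    then obtain n where "B < real n * integral {0..\<eta>} d"
      using reals_Archimedean3 by blast
    then show False using bd[of n] int_n[of n] by (simp add: d_def[abs_def])
  qed
  \<comment> \<open>A continuous nonnegative function with zero integral vanishes pointwise, and
    \<open>d 0\<close> is \<open>D x\<close>.\<close>
  then have "d 0 = 0"
    using integral_eq_0_iff[OF cont[of 0 \<eta>] \<eta> d_nonneg] \<eta> by auto
  then show ?thesis by (simp add: d_def)
qed

lemma integral_bellman_undiscounted_attractive:
  assumes J: "continuous_on UNIV J" "pos_definite J" "radially_unbounded J"
    and \<eta>: "\<eta> > 0" and inf: "\<And>x. t_max F x = \<infinity>" and \<alpha>: "\<alpha> = 0"
    and eq: "\<And>y. J y = acc y \<eta> + exp (- \<alpha> * \<eta>) * J (traj F y \<eta>)"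
    and fin: "\<And>x. total x < \<infinity>" and tot: "continuous_on UNIV (\<lambda>x. enn2real (total x))"
    and tot_le: "\<And>x. enn2real (total x) \<le> J x"
    and cc_pos: "\<And>y. y \<noteq> 0 \<Longrightarrow> cc y > 0"
  shows "globally_attractive F"
  unfolding globally_attractive_def
proof (intro allI conjI inf)
  fix x
  let ?V = "\<lambda>x. enn2real (total x)"
  have nonneg: "J y \<ge> 0" for y using J(2) by (rule pos_definite_nonneg)
  have dp: "?V y = acc y t + ?V (traj F y t)" if "t \<ge> 0" for y t
    using total_dynamic_programming[OF inf fin that, of y] by (simp add: \<alpha>)
  have V_pos: "pos_definite ?V"
    unfolding pos_definite_def
  proof (intro conjI allI impI)
    show "?V 0 = 0" using tot_le[of 0] J(2) by (simp add: pos_definite_def order_antisym)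
    fix y :: "real ^ 'l" assume y: "y \<noteq> 0"
    \<comment> \<open>The cost is positive at time 0, hence by continuity its integral over any
      initial interval is positive.\<close>
    have "acc y 1 \<noteq> 0"
    proof
      assume "acc y 1 = 0"
      then have "rate y 0 = 0"
        using integral_eq_0_iff[of 0 1 "rate y"] rate_continuous_atMost[of 1 y] rate_nonneg inf
        by (auto simp: acc_def)
      then show False using cc_pos[OF y] by (simp add: rate_def)
    qed
    then show "?V y > 0"
      using dp[of 1 y] acc_nonneg[of y 1] enn2real_nonneg[of "total (traj F y 1)"] by linarith
  qed
  \<comment> \<open>Every time is some \<open>s\<close> in the first period plus a multiple of
    \<open>\<eta>\<close>, and \<open>J\<close> does not increase along the latter steps; the
    maximum \<open>B\<close> over the first period therefore bounds \<open>J\<close> at all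
    times.\<close>
  have "continuous_on {0..\<eta>} (\<lambda>s. J (traj F x s))"
    by (intro continuous_on_compose2[OF J(1)] continuous_on_subset[OF traj_continuous[OF inf]]) auto
  then obtain B where B: "\<And>s. s \<in> {0..\<eta>} \<Longrightarrow> J (traj F x s) \<le> B"
    using continuous_attains_sup[of "{0..\<eta>}" "\<lambda>s. J (traj F x s)"] \<eta> by fastforce
  obtain R where R: "\<And>y. J y \<le> B \<Longrightarrow> 0 \<le> J y \<Longrightarrow> norm y \<le> R"
    using radially_unbounded_sublevel[OF J(3)] by blast
  have bd: "norm (traj F x t) \<le> R" if t: "t \<ge> 0" for t
  proof (rule R[OF _ nonneg])
    define n where "n = nat \<lfloor>t / \<eta>\<rfloor>"
    define s where "s = t - real n * \<eta>"
    have "real n = of_int \<lfloor>t / \<eta>\<rfloor>" using t \<eta> by (simp add: n_def)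
    then have "real n \<le> t / \<eta>" "t / \<eta> < real n + 1" by linarith+
    then have s: "0 \<le> s" "s \<le> \<eta>" using \<eta> by (simp_all add: s_def field_simps)
    have "J (traj F (traj F x s) (real n * \<eta>)) \<le> J (traj F x s)"
      using integral_bellman_iterate[OF \<eta> inf eq, of "traj F x s" n]
        acc_nonneg[of "traj F x s" "real n * \<eta>"] by (simp add: \<alpha>)
    also have "traj F (traj F x s) (real n * \<eta>) = traj F x t"
      using traj_add[OF inf s(1), of "real n * \<eta>" x] \<eta> by (simp add: s_def)
    also have "J (traj F x s) \<le> B" using B s by simp
    finally show "J (traj F x t) \<le> B" .
  qed
  \<comment> \<open>By dynamic programming the cost-to-go at time \<open>t\<close> is
    \<open>?V x - acc x t\<close>, the tail of a convergent integral.\<close>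
  have "((\<lambda>t. ?V x - acc x t) \<longlongrightarrow> ?V x - ?V x) at_top"
    by (intro tendsto_intros acc_tendsto_total inf fin)
  then have "((\<lambda>t. ?V (traj F x t)) \<longlongrightarrow> ?V x - ?V x) at_top"
    by (rule Lim_transform_eventually)
      (use dp[of _ x] in \<open>auto intro!: eventually_mono[OF eventually_ge_at_top[of 0]]\<close>)
  then have "((\<lambda>t. ?V (traj F x t)) \<longlongrightarrow> 0) at_top" by simp
  then show "(traj F x \<longlongrightarrow> 0) at_top"
    by (rule pos_definite_tendsto_0[OF V_pos tot]) (rule bd)
qed

lemma integral_bellman_total_eq:
  assumes J: "continuous_on UNIV J" "pos_definite J" "radially_unbounded J" and \<alpha>: "\<alpha> \<ge> 0"
    and \<eta>: "\<eta> > 0" and inf: "\<And>x. t_max F x = \<infinity>"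
    and eq: "\<And>y. J y = acc y \<eta> + exp (- \<alpha> * \<eta>) * J (traj F y \<eta>)"
    and fin: "\<And>x. total x < \<infinity>" and tot: "continuous_on UNIV (\<lambda>x. enn2real (total x))"
    and cc_pos: "\<And>y. y \<noteq> 0 \<Longrightarrow> cc y > 0"
    and C: "\<alpha> \<noteq> 0 \<Longrightarrow> globally_attractive F \<or> (\<exists>\<kappa>>0. \<forall>y. \<kappa> * J y \<le> cc y)"
  shows "enn2real (total x) = J x"
proof -
  have nonneg: "J y \<ge> 0" for y using J(2) by (rule pos_definite_nonneg)
  have it: "J y = acc y (real n * \<eta>) + exp (- \<alpha> * (real n * \<eta>)) * J (traj F y (real n * \<eta>))" for y n
    by (rule integral_bellman_iterate[OF \<eta> inf eq])
  have acc_le: "acc y (real n * \<eta>) \<le> J y" for y n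
    using it[of y n] nonneg[of "traj F y (real n * \<eta>)"] by (smt (verit) exp_gt_zero mult_nonneg_nonneg)
  have "total y \<le> ennreal (J y)" for y
    by (rule total_le[OF inf \<eta> acc_le])
  then have tot_le: "enn2real (total y) \<le> J y" for y
    using nonneg by (simp add: enn2real_leI)
  \<comment> \<open>For \<open>\<alpha> = 0\<close> attractivity has just been established; for
    \<open>\<alpha> \<noteq> 0\<close> the alternative is hypothesis \<open>C\<close>.\<close>
  consider "globally_attractive F" | \<kappa> where "\<kappa> > 0" "\<And>y. \<kappa> * J y \<le> cc y"
    using C integral_bellman_undiscounted_attractive[OF J \<eta> inf _ eq fin tot tot_le cc_pos] by blast
  then show ?thesis
  proof cases
    case 1
    have lim_t: "filterlim (\<lambda>n. real n * \<eta>) at_top sequentially"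
      using filterlim_real_sequentially \<eta>
      by (simp add: filterlim_at_top_mult_tendsto_pos[OF tendsto_const])
    have "((\<lambda>t. J (traj F x t)) \<longlongrightarrow> J 0) at_top"
      using 1 J(1)
      by (intro isCont_tendsto_compose[of _ J]) (auto simp: globally_attractive_def continuous_on_eq_continuous_at)
    then have "((\<lambda>t. J (traj F x t)) \<longlongrightarrow> 0) at_top" using J(2) by (simp add: pos_definite_def)
    then have lim: "(\<lambda>n. J (traj F x (real n * \<eta>))) \<longlonglongrightarrow> 0"
      using lim_t by (rule filterlim_compose)
    have "(\<lambda>n. exp (- \<alpha> * (real n * \<eta>)) * J (traj F x (real n * \<eta>))) \<longlonglongrightarrow> 0"
      by (rule tendsto_sandwich[OF _ _ tendsto_const lim])
        (use \<alpha> \<eta> nonneg in \<open>auto intro!: always_eventually mult_left_le_one_le\<close>)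
    then have "total x = ennreal (J x)"
      by (intro total_eqI[OF inf \<eta> nonneg it])
    then show ?thesis using nonneg by simp
  next
    case 2
    \<comment> \<open>Here decay of the discounted \<open>J\<close> is not known in advance. The gap
      lies between 0 and \<open>J\<close>, so \<open>\<kappa> * J y \<le> cc y\<close> bounds its
      discounted integral by \<open>J x / \<kappa>\<close>.\<close>
    let ?D = "\<lambda>y. J y - enn2real (total y)"
    have D_cont: "continuous_on UNIV ?D" by (intro continuous_intros J tot)
    have "?D x = 0"
    proof (rule periodic_discounted_eq_0[OF \<eta> inf D_cont])
      show "?D y \<ge> 0" for y using tot_le[of y] by simp
      show "?D y = exp (- \<alpha> * \<eta>) * ?D (traj F y \<eta>)" for y
        using eq[of y] total_dynamic_programming[OF inf fin, of \<eta> y] \<eta> by (simp add: right_diff_distrib)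
      fix n
      let ?t = "real n * \<eta>"
      have t: "?t \<ge> 0" using \<eta> by simp
      have "continuous_on {0..?t} (\<lambda>t. exp (- \<alpha> * t) * ?D (traj F x t))"
        by (intro continuous_intros continuous_on_compose2[OF J(1)] continuous_on_compose2[OF tot]
            continuous_on_subset[OF traj_continuous[OF inf]]) auto
      then have "integral {0..?t} (\<lambda>t. exp (- \<alpha> * t) * ?D (traj F x t))
          \<le> integral {0..?t} (\<lambda>t. exp (- \<alpha> * t) * J (traj F x t))"
        by (intro integral_le integrable_continuous_real integral_scaled_value_le[OF inf J(1) t 2]) auto
      also have "\<dots> \<le> acc x ?t / \<kappa>"
        using inf J(1) t 2 by (rule integral_scaled_value_le(2))
      also have "\<dots> \<le> J x / \<kappa>" using acc_le 2(1) by (simp add: divide_right_mono)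
      finally show "integral {0..?t} (\<lambda>t. exp (- \<alpha> * t) * ?D (traj F x t)) \<le> J x / \<kappa>" .
    qed
    then show ?thesis by simp
  qed
qed

text \<open>Both sides of the balance are differentiated in the horizon at 0, from the right; the
  left side is constant.\<close>

lemma balance_imp_diff_bellman:
  assumes J: "C1 J" and inf: "t_max F x = \<infinity>"
    and bal: "\<And>t. t \<ge> 0 \<Longrightarrow> J x = acc x t + exp (- \<alpha> * t) * J (traj F x t)"
  shows "grad J x \<bullet> F x = \<alpha> * J x - cc x"
proof -
  have dJ: "((\<lambda>s. J (traj F x s)) has_real_derivative (grad J x \<bullet> F x)) (at 0 within {0..})"
    using has_derivative_compose[OF traj_deriv[OF inf, of 0, unfolded has_vector_derivative_def]
        C1_GDERIV[OF J, unfolded gderiv_def]]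
    by (simp add: has_field_derivative_def inner_commute mult_commute_abs)
  have dacc: "(acc x has_real_derivative rate x 0) (at 0 within {0..})"
    using acc_has_derivative[OF inf, of 0] by (simp add: has_real_derivative_iff_has_vector_derivative)
  have "((\<lambda>t. acc x t + exp (- \<alpha> * t) * J (traj F x t)) has_real_derivative
      (cc x + (grad J x \<bullet> F x - \<alpha> * J x))) (at 0 within {0..})"
    by (rule derivative_eq_intros dJ dacc refl)+ (simp add: rate_def)
  then have "((\<lambda>t. J x) has_vector_derivative (cc x + (grad J x \<bullet> F x - \<alpha> * J x))) (at 0 within {0..})"
    unfolding has_real_derivative_iff_has_vector_derivative
    by (rule has_vector_derivative_transform[rotated 2]) (simp, rule bal, simp)
  \<comment> \<open>The compact interval makes uniqueness of one-sided derivatives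
    applicable.\<close>
  then have "((\<lambda>t. J x) has_vector_derivative (cc x + (grad J x \<bullet> F x - \<alpha> * J x))) (at 0 within {0..1})"
    by (auto simp: has_real_derivative_iff_has_vector_derivative intro: has_vector_derivative_within_subset)
  moreover have "((\<lambda>t. J x) has_vector_derivative 0) (at 0 within {0..1::real})"
    by (rule has_vector_derivative_const)
  ultimately have "cc x + (grad J x \<bullet> F x - \<alpha> * J x) = 0"
    using vector_derivative_unique_within_closed_interval[of 0 1 0] by (metis atLeastAtMost_iff box_real(2) order_refl zero_le_one zero_less_one)
  then show ?thesis by simp
qed

end

subsection \<open>Policy iteration\<close>

locale optimal_control =
  fixes U :: "(real ^ 'm) set"
    and f :: "real ^ 'l \<Rightarrow> real ^ 'm \<Rightarrow> real ^ 'l"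
    and c :: "real ^ 'l \<Rightarrow> real ^ 'm \<Rightarrow> real"
    and \<gamma> :: real
  assumes dynamics: "loc_lipschitz_on (UNIV \<times> U) (\<lambda>(x, u). f x u)" "f 0 0 = 0"
    and cost_continuous: "continuous_on (UNIV \<times> U) (\<lambda>(x, u). c x u)"
    and cost_pos_def: "c 0 0 = 0" "\<And>x u. u \<in> U \<Longrightarrow> (x, u) \<noteq> (0, 0) \<Longrightarrow> c x u > 0"
    and discount: "0 < \<gamma>" "\<gamma> \<le> 1"
begin

lemma closed_loop_cost_pos:
  assumes "\<mu> \<in> Pi0 U" "x \<noteq> 0"
  shows "closed_loop c \<mu> x > 0"
  using assms cost_pos_def(2)[of "\<mu> x" x] by (auto simp: closed_loop_def Pi0_def is_policy_def)

lemma controlled_closed_loop: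
  assumes \<mu>: "\<mu> \<in> Pi0 U"
  shows "controlled (closed_loop f \<mu>) (closed_loop c \<mu>)"
proof
  have graph: "(\<lambda>x. (x, \<mu> x)) ` UNIV \<subseteq> UNIV \<times> U"
    using \<mu> by (auto simp: Pi0_def is_policy_def)
  show "loc_lipschitz_on UNIV (closed_loop f \<mu>)"
    using loc_lipschitz_on_compose[OF loc_lipschitz_on_graph dynamics(1) graph] \<mu>
    by (simp add: closed_loop_def[abs_def] Pi0_def)
  have "continuous_on UNIV (\<lambda>x. (x, \<mu> x))"
    using \<mu> by (intro continuous_intros) (simp add: Pi0_def is_policy_def)
  then have "continuous_on UNIV (\<lambda>x. (\<lambda>(x, u). c x u) (x, \<mu> x))"
    using graph by (rule continuous_on_compose2[OF cost_continuous])
  then show "continuous_on UNIV (closed_loop c \<mu>)" by (simp add: closed_loop_def[abs_def])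
  fix x
  show "closed_loop c \<mu> x \<ge> 0"
    using closed_loop_cost_pos[OF \<mu>, of x] \<mu> cost_pos_def(1)
    by (cases "x = 0") (auto simp: closed_loop_def Pi0_def)
qed

lemma cost_value_eq_total:
  assumes \<mu>: "\<mu> \<in> Pi0 U" and inf: "t_max (closed_loop f \<mu>) x = \<infinity>"
  shows "cost_value f c \<gamma> \<mu> x =
    controlled.total (closed_loop f \<mu>) (closed_loop c \<mu>) (- ln \<gamma>) x"
proof -
  interpret controlled "closed_loop f \<mu>" "closed_loop c \<mu>" "- ln \<gamma>"
    using \<mu> by (rule controlled_closed_loop)
  show ?thesis
    using inf discount by (simp add: cost_value_def total_def rate_def cost_along_def powr_def mult.commute)
qed

text \<open>Passing from \<open>v\<close> to \<open>- v\<close> and from powers of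
  \<open>\<gamma>\<close> to exponentials puts the equation into the form of the lemmas on
  \<open>acc\<close>.\<close>

lemma integral_bellman_iff:
  assumes \<mu>: "\<mu> \<in> Pi0 U"
  shows "integral_bellman f c \<gamma> \<eta> \<mu> v \<longleftrightarrow> (\<forall>x. ereal \<eta> < t_max (closed_loop f \<mu>) x \<and>
    - v x = controlled.acc (closed_loop f \<mu>) (closed_loop c \<mu>) (- ln \<gamma>) x \<eta> +
      exp (- (- ln \<gamma>) * \<eta>) * - v (traj (closed_loop f \<mu>) x \<eta>))"
proof -
  interpret controlled "closed_loop f \<mu>" "closed_loop c \<mu>" "- ln \<gamma>"
    using \<mu> by (rule controlled_closed_loop)
  have "integral {0..\<eta>} (\<lambda>t. \<gamma> powr t * (- cost_along f c \<mu> x t)) = - acc x \<eta>" for x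
  proof -
    have "(\<lambda>t. \<gamma> powr t * (- cost_along f c \<mu> x t)) = (\<lambda>t. - rate x t)"
      using discount by (simp add: fun_eq_iff rate_def cost_along_def powr_def mult.commute)
    then show ?thesis by (simp add: acc_def)
  qed
  then show ?thesis
    using discount unfolding integral_bellman_def
    by (intro iff_allI conj_cong refl) (auto simp: powr_def mult.commute)
qed

lemma diff_bellman_iff:
  assumes "C1 v"
  shows "diff_bellman f c \<gamma> \<mu> v \<longleftrightarrow>
    (\<forall>x. grad (\<lambda>x. - v x) x \<bullet> closed_loop f \<mu> x = (- ln \<gamma>) * - v x - closed_loop c \<mu> x)"
  unfolding diff_bellman_def grad_uminus[OF assms] hamiltonian_def closed_loop_def
  by (intro iff_allI) auto

text \<open>The gradient vanishes at the minimum of \<open>- v\<close>. At state 0 and costate 0 the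
  Hamiltonian is the negative cost, whose only maximiser over \<open>U\<close> is the action 0, so
  the new policy vanishes at the origin.\<close>

lemma improved_policy_Pi0:
  assumes lip: "loc_lipschitz_on UNIV (\<lambda>(x, p). ustar x p)"
    and argmax: "\<And>x p. is_arg_max (\<lambda>u. hamiltonian f c x u p) (\<lambda>u. u \<in> U) (ustar x p)"
    and U0: "0 \<in> U" and v: "C1 v" and J: "C1_Lip (\<lambda>x. - v x)" "pos_definite (\<lambda>x. - v x)"
  shows "(\<lambda>x. ustar x (grad v x)) \<in> Pi0 U"
proof -
  have C1J: "C1 (\<lambda>x. - v x)" using J(1) by (simp add: C1_Lip_def)
  have "grad v = (\<lambda>x. - grad (\<lambda>x. - v x) x)" using grad_uminus[OF C1J] by simp
  then have "loc_lipschitz_on UNIV (grad v)"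
    using J(1) by (simp add: C1_Lip_def loc_lipschitz_on_def local_lipschitz_minus)
  from loc_lipschitz_on_compose[OF loc_lipschitz_on_graph[OF this] lip]
  have l: "loc_lipschitz_on UNIV (\<lambda>x. ustar x (grad v x))" by simp
  have inU: "ustar x p \<in> U" for x p
    using argmax[of x p] by (simp add: is_arg_max_def)
  have "c 0 (ustar 0 0) \<le> c 0 0"
    using argmax[of 0 0] U0 by (force simp: is_arg_max_def hamiltonian_def not_less)
  then have "ustar 0 0 = 0" using cost_pos_def(1) cost_pos_def(2)[OF inU, of 0 0 0] by fastforce
  moreover have "grad v 0 = 0"
    using pos_definite_grad_0[OF C1J J(2)] grad_uminus[OF v] by (simp add: fun_eq_iff)
  ultimately show ?thesis
    using l inU loc_lipschitz_on_continuous[OF l] by (auto simp: Pi0_def is_policy_def)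
qed

lemma policy_improvement_diff_inequality:
  assumes argmax: "\<And>x p. is_arg_max (\<lambda>u. hamiltonian f c x u p) (\<lambda>u. u \<in> U) (ustar x p)"
    and \<mu>: "\<mu> \<in> Pi0 U" and v: "C1 v" and bell: "diff_bellman f c \<gamma> \<mu> v"
    and \<mu>': "\<And>x. \<mu>' x = ustar x (grad v x)"
  shows "grad (\<lambda>x. - v x) x \<bullet> closed_loop f \<mu>' x \<le> (- ln \<gamma>) * - v x - closed_loop c \<mu>' x"
proof -
  have "\<mu> x \<in> U" using \<mu> by (auto simp: Pi0_def is_policy_def)
  then have "hamiltonian f c x (\<mu> x) (grad v x) \<le> hamiltonian f c x (\<mu>' x) (grad v x)"
    using argmax[of x "grad v x"] by (auto simp: is_arg_max_def \<mu>' not_less)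
  moreover have "- ln \<gamma> * v x = hamiltonian f c x (\<mu> x) (grad v x)"
    using bell by (simp add: diff_bellman_def)
  ultimately show ?thesis
    by (simp add: grad_uminus[OF v] hamiltonian_def closed_loop_def)
qed

lemma cost_value_le:
  assumes \<mu>: "\<mu> \<in> Pi0 U" and J: "C1 J" "pos_definite J" "radially_unbounded J"
    and le: "\<And>y. grad J y \<bullet> closed_loop f \<mu> y \<le> (- ln \<gamma>) * J y - closed_loop c \<mu> y"
  shows "cost_value f c \<gamma> \<mu> x \<le> ennreal (J x)"
proof -
  interpret controlled "closed_loop f \<mu>" "closed_loop c \<mu>" "- ln \<gamma>"
    using \<mu> by (rule controlled_closed_loop)
  have "- ln \<gamma> \<ge> 0" using discount by simp
  note [simp] = global_existence[OF J this le] total_le_value[OF J this le]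
  show ?thesis by (simp add: cost_value_eq_total[OF \<mu>])
qed

text \<open>Along the closed loop the derivative of \<open>- v\<close> is \<open>\<alpha>\<close>
  times \<open>- v\<close> minus the cost, so \<open>less\<close> makes it a strict Lyapunov
  function. For \<open>\<gamma> = 1\<close>, \<open>less\<close> reduces to positivity of the
  cost.\<close>

lemma globally_asymp_stable_closed_loop:
  assumes \<mu>: "\<mu> \<in> Pi0 U" and v: "C1 v"
    and J: "C1 (\<lambda>x. - v x)" "pos_definite (\<lambda>x. - v x)" "radially_unbounded (\<lambda>x. - v x)"
    and bell: "diff_bellman f c \<gamma> \<mu> v"
    and less: "\<And>x. x \<noteq> 0 \<Longrightarrow> (- ln \<gamma>) * - v x < closed_loop c \<mu> x"
  shows "globally_asymp_stable (closed_loop f \<mu>)"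
proof -
  interpret controlled "closed_loop f \<mu>" "closed_loop c \<mu>" "- ln \<gamma>"
    using \<mu> by (rule controlled_closed_loop)
  show ?thesis
  proof (rule lyapunov_global_asymp_stable[OF J])
    show "closed_loop f \<mu> 0 = 0" using \<mu> dynamics(2) by (simp add: closed_loop_def Pi0_def)
    show "grad (\<lambda>x. - v x) y \<bullet> closed_loop f \<mu> y < 0" if "y \<noteq> 0" for y
      using bell less[OF that] unfolding diff_bellman_iff[OF v] by simp
  qed
qed

lemma integral_bellman_imp_diff_bellman:
  assumes \<mu>: "\<mu> \<in> Pi0 U" and \<eta>: "\<eta> > 0" and bell: "integral_bellman f c \<gamma> \<eta> \<mu> v"
    and v: "C1 v"
    and J: "C1 (\<lambda>x. - v x)" "pos_definite (\<lambda>x. - v x)" "radially_unbounded (\<lambda>x. - v x)"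
    and C: "\<gamma> \<noteq> 1 \<Longrightarrow> globally_attractive (closed_loop f \<mu>) \<or>
      (\<exists>\<kappa>>0. \<forall>x. \<kappa> * - v x \<le> closed_loop c \<mu> x)"
    and regular: "\<And>\<nu>. \<nu> \<in> admissible U f c \<gamma> \<Longrightarrow> C1 (value_fun f c \<gamma> \<nu>)"
  shows "diff_bellman f c \<gamma> \<mu> v"
proof -
  interpret controlled "closed_loop f \<mu>" "closed_loop c \<mu>" "- ln \<gamma>"
    using \<mu> by (rule controlled_closed_loop)
  let ?J = "\<lambda>x. - v x" and ?F = "closed_loop f \<mu>"
  have inf: "t_max ?F x = \<infinity>" for x
    using bell \<eta> unfolding integral_bellman_iff[OF \<mu>]
    by (intro uniform_existence_imp_global[OF \<eta>]) auto
  have eq: "?J y = acc y \<eta> + exp (- (- ln \<gamma>) * \<eta>) * ?J (traj ?F y \<eta>)" for y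
    using bell unfolding integral_bellman_iff[OF \<mu>] by blast
  have nonneg: "?J y \<ge> 0" for y using J(2) by (rule pos_definite_nonneg)
  have "acc y (real n * \<eta>) \<le> ?J y" for y n
    using integral_bellman_iterate[OF \<eta> inf eq, of y n]
      mult_nonneg_nonneg[OF exp_ge_zero[of "- (- ln \<gamma>) * (real n * \<eta>)"] nonneg[of "traj ?F y (real n * \<eta>)"]]
    by linarith
  then have fin: "total y < \<infinity>" for y
    using total_le[OF inf \<eta>, of y "?J y"] by (auto intro: le_less_trans)
  \<comment> \<open>Admissibility has to come first, because \<open>regular\<close>, the source of
    continuity of the cost value, speaks only of admissible policies.\<close>
  then have "\<mu> \<in> admissible U f c \<gamma>"
    using \<mu> by (simp add: admissible_def cost_value_eq_total inf)
  then have "C1 (value_fun f c \<gamma> \<mu>)" by (rule regular)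
  then have "continuous_on UNIV (\<lambda>x. - value_fun f c \<gamma> \<mu> x)"
    by (intro continuous_intros C1_continuous)
  then have tot: "continuous_on UNIV (\<lambda>x. enn2real (total x))"
    by (simp add: value_fun_def cost_value_eq_total[OF \<mu> inf])
  have C': "globally_attractive ?F \<or> (\<exists>\<kappa>>0. \<forall>x. \<kappa> * ?J x \<le> closed_loop c \<mu> x)" if "- ln \<gamma> \<noteq> 0"
    using that by (intro C) auto
  have \<alpha>: "- ln \<gamma> \<ge> 0" using discount by simp
  have total_eq: "enn2real (total x) = ?J x" for x
    by (rule integral_bellman_total_eq[OF C1_continuous[OF J(1)] J(2,3) \<alpha> \<eta> inf eq fin tot])
      (use closed_loop_cost_pos[OF \<mu>] C' in auto)
  \<comment> \<open>Identifying \<open>?J\<close> with the cost value extends the equation from the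
    single horizon \<open>\<eta>\<close> to every horizon, which permits differentiation at
    0.\<close>
  have bal: "?J x = acc x t + exp (- (- ln \<gamma>) * t) * ?J (traj ?F x t)" if "t \<ge> 0" for x t
    using total_dynamic_programming[OF inf fin that, of x] unfolding total_eq .
  have "grad ?J x \<bullet> ?F x = (- ln \<gamma>) * ?J x - closed_loop c \<mu> x" for x
    by (rule balance_imp_diff_bellman[OF J(1) inf bal])
  then show ?thesis unfolding diff_bellman_iff[OF v] by blast
qed

lemma diff_bellman_imp_cost_value:
  assumes \<mu>: "\<mu> \<in> Pi0 U" and bell: "diff_bellman f c \<gamma> \<mu> v" and v: "C1 v"
    and J: "C1 (\<lambda>x. - v x)" "pos_definite (\<lambda>x. - v x)" "radially_unbounded (\<lambda>x. - v x)"
    and C: "\<gamma> \<noteq> 1 \<Longrightarrow> globally_attractive (closed_loop f \<mu>) \<or>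
      (\<exists>\<kappa>>0. \<forall>x. \<kappa> * - v x \<le> closed_loop c \<mu> x)"
  shows "cost_value f c \<gamma> \<mu> x = ennreal (- v x)"
proof -
  interpret controlled "closed_loop f \<mu>" "closed_loop c \<mu>" "- ln \<gamma>"
    using \<mu> by (rule controlled_closed_loop)
  have \<alpha>: "- ln \<gamma> \<ge> 0" using discount by simp
  have eq: "grad (\<lambda>x. - v x) y \<bullet> closed_loop f \<mu> y = (- ln \<gamma>) * - v y - closed_loop c \<mu> y" for y
    using bell unfolding diff_bellman_iff[OF v] by blast
  have C': "globally_attractive (closed_loop f \<mu>) \<or> (\<exists>\<kappa>>0. \<forall>x. \<kappa> * - v x \<le> closed_loop c \<mu> x)"
  proof (cases "\<gamma> = 1")
    case True
    then have "globally_asymp_stable (closed_loop f \<mu>)"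
      using closed_loop_cost_pos[OF \<mu>]
      by (intro globally_asymp_stable_closed_loop[OF \<mu> v J bell]) auto
    then show ?thesis by (simp add: globally_asymp_stable_def)
  qed (rule C)
  have "t_max (closed_loop f \<mu>) x = \<infinity>"
    by (rule global_existence[OF J \<alpha>]) (simp add: eq)
  then show ?thesis
    using diff_bellman_total_eq[OF J \<alpha> eq C'] by (simp add: cost_value_eq_total[OF \<mu>])
qed

end

theorem theorem5p19:
  fixes U :: "(real ^ 'm) set"
    and f :: "real ^ 'l \<Rightarrow> real ^ 'm \<Rightarrow> real ^ 'l"
    and c :: "real ^ 'l \<Rightarrow> real ^ 'm \<Rightarrow> real"
    and \<gamma> \<alpha> :: real
    and ustar :: "real ^ 'l \<Rightarrow> real ^ 'l \<Rightarrow> real ^ 'm"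
    and v J :: "nat \<Rightarrow> real ^ 'l \<Rightarrow> real"
    and \<pi> :: "nat \<Rightarrow> real ^ 'l \<Rightarrow> real ^ 'm"
  assumes action_space: "\<exists>Q. open Q \<and> (U = Q \<or> U = Q \<union> frontier Q)" "0 \<in> U"
    and dynamics: "loc_lipschitz_on (UNIV \<times> U) (\<lambda>(x, u). f x u)" "f 0 0 = 0"
    and cost_continuous: "continuous_on (UNIV \<times> U) (\<lambda>(x, u). c x u)"
    and cost_pos_def: "c 0 0 = 0" "\<forall>x. \<forall>u\<in>U. (x, u) \<noteq> (0, 0) \<longrightarrow> c x u > 0"
    and discount: "0 < \<gamma>" "\<gamma> \<le> 1" "\<alpha> = - ln \<gamma>"
    and ustar_lipschitz: "loc_lipschitz_on UNIV (\<lambda>(x, p). ustar x p)"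
    and ustar_argmax:
      "\<forall>x p. is_arg_max (\<lambda>u. hamiltonian f c x u p) (\<lambda>u. u \<in> U) (ustar x p)"
    and value_regular: "\<forall>\<mu> \<in> admissible U f c \<gamma>. C1_Lip (value_fun f c \<gamma> \<mu>)"
    and cost_nonvanishing: "\<forall>\<mu> \<in> Pi0 U. radially_nonvanishing (closed_loop c \<mu>)"
    and J_eq: "\<forall>i x. J i x = - v i x"
    and A: "\<pi> 0 \<in> admissible U f c \<gamma>"
    and B: "\<forall>i\<ge>1. C1_Lip (J i) \<and> pos_definite (J i) \<and> radially_unbounded (J i)"
    and C: "\<forall>i\<ge>1. \<gamma> \<noteq> 1 \<longrightarrow>
        globally_attractive (closed_loop f (\<pi> (i - 1))) \<or>
        (\<exists>\<kappa>>0. \<forall>x. \<kappa> * J i x \<le> closed_loop c (\<pi> (i - 1)) x)"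
    and generated:
      "DPI f c \<gamma> ustar v \<pi> \<or>
       (\<exists>\<eta>>0. IPI f c \<gamma> ustar \<eta> v \<pi> \<and>
          (\<forall>i\<ge>1.
             (\<gamma> \<noteq> 1 \<longrightarrow>
                radially_unbounded (closed_loop c (\<pi> (i - 1))) \<and>
                (\<exists>a \<zeta>. 0 \<le> a \<and> a < \<alpha> \<and>
                   (\<forall>x t. 0 \<le> t \<and> ereal t < t_max (closed_loop f (\<pi> (i - 1))) x \<longrightarrow>
                      cost_along f c (\<pi> (i - 1)) x t \<le> \<zeta> x * exp (a * t)))) \<or>
             (\<gamma> \<noteq> 1 \<longrightarrow>
                (\<forall>\<epsilon>>0. \<exists>\<eta>'. 0 < \<eta>' \<and> \<eta>' < \<epsilon> \<and>
                   integral_bellman f c \<gamma> \<eta>' (\<pi> (i - 1)) (v i)))))"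
  shows "(\<forall>i\<ge>1. \<pi> (i - 1) \<in> admissible U f c \<gamma> \<and>
            (\<forall>x. ennreal (J i x) = cost_value f c \<gamma> (\<pi> (i - 1)) x \<and>
                 cost_value f c \<gamma> (\<pi> (i - 1)) x \<ge> cost_value f c \<gamma> (\<pi> i) x)) \<and>
         (\<forall>i\<ge>1. \<gamma> = 1 \<or> (\<forall>x. x \<noteq> 0 \<longrightarrow> \<alpha> * J i x < closed_loop c (\<pi> (i - 1)) x) \<longrightarrow>
            globally_asymp_stable (closed_loop f (\<pi> (i - 1))))"
proof -
  interpret optimal_control U f c \<gamma>
    using dynamics cost_continuous cost_pos_def discount(1,2) by unfold_locales auto
  have J: "J i = (\<lambda>x. - v i x)" for i using J_eq by (simp add: fun_eq_iff)
  have B': "C1_Lip (\<lambda>x. - v i x)" "C1 (\<lambda>x. - v i x)" "pos_definite (\<lambda>x. - v i x)"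
      "radially_unbounded (\<lambda>x. - v i x)" if "i \<ge> 1" for i
    using B that by (auto simp: J C1_Lip_def)
  have v: "C1 (v i)" and \<pi>: "\<pi> i = (\<lambda>x. ustar x (grad (v i) x))" if "i \<ge> 1" for i
    using generated that by (auto simp: DPI_def IPI_def fun_eq_iff)
  \<comment> \<open>No induction is involved: \<open>A\<close> settles the initial policy, and every
    later one is \<open>ustar\<close> composed with a gradient that is regular by
    \<open>B\<close>.\<close>
  have Pi0: "\<pi> i \<in> Pi0 U" for i
  proof (cases "i \<ge> 1")
    case True
    then show ?thesis
      unfolding \<pi>[OF True] using ustar_argmax
      by (intro improved_policy_Pi0 ustar_lipschitz action_space(2) v B') auto
  next
    case False
    then have "i = 0" by simp
    then show ?thesis using A by (simp add: admissible_def)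
  qed
  have C': "globally_attractive (closed_loop f (\<pi> (i - 1))) \<or>
      (\<exists>\<kappa>>0. \<forall>x. \<kappa> * - v i x \<le> closed_loop c (\<pi> (i - 1)) x)" if "i \<ge> 1" "\<gamma> \<noteq> 1" for i
    using C that by (simp add: J)
  \<comment> \<open>From here on both algorithms are treated alike through the differential
    equation.\<close>
  have bell: "diff_bellman f c \<gamma> (\<pi> (i - 1)) (v i)" if i: "i \<ge> 1" for i
    using generated
  proof (elim disjE exE conjE)
    assume "DPI f c \<gamma> ustar v \<pi>"
    then show ?thesis using i by (simp add: DPI_def)
  next
    fix \<eta> assume \<eta>: "\<eta> > 0" and "IPI f c \<gamma> ustar \<eta> v \<pi>"
    then have "integral_bellman f c \<gamma> \<eta> (\<pi> (i - 1)) (v i)" using i by (simp add: IPI_def)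
    then show ?thesis
      using value_regular
      by (intro integral_bellman_imp_diff_bellman[OF Pi0 \<eta> _ v[OF i] B'(2-4)[OF i] C'[OF i]])
        (auto simp: C1_Lip_def)
  qed
  \<comment> \<open>As the right-hand side is finite, this also gives admissibility of the
    policy.\<close>
  have val: "cost_value f c \<gamma> (\<pi> (i - 1)) x = ennreal (J i x)" if i: "i \<ge> 1" for i x
    unfolding J by (rule diff_bellman_imp_cost_value[OF Pi0 bell[OF i] v[OF i] B'(2-4)[OF i] C'[OF i]])
  have improve: "cost_value f c \<gamma> (\<pi> i) x \<le> ennreal (J i x)" if i: "i \<ge> 1" for i x
    unfolding J
  proof (rule cost_value_le[OF Pi0 B'(2-4)[OF i]])
    fix y
    show "grad (\<lambda>x. - v i x) y \<bullet> closed_loop f (\<pi> i) y \<le> (- ln \<gamma>) * - v i y - closed_loop c (\<pi> i) y"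
      by (rule policy_improvement_diff_inequality[OF _ Pi0 v[OF i] bell[OF i]])
        (use ustar_argmax \<pi>[OF i] in auto)
  qed
  have stable: "globally_asymp_stable (closed_loop f (\<pi> (i - 1)))"
    if i: "i \<ge> 1" and "\<gamma> = 1 \<or> (\<forall>x. x \<noteq> 0 \<longrightarrow> \<alpha> * J i x < closed_loop c (\<pi> (i - 1)) x)" for i
    using that closed_loop_cost_pos[OF Pi0] \<open>\<alpha> = - ln \<gamma>\<close>
    by (intro globally_asymp_stable_closed_loop[OF Pi0 v[OF i] B'(2-4)[OF i] bell[OF i]])
      (auto simp: J)
  show ?thesis
    using stable val improve Pi0 by (auto simp: admissible_def)
qed

end
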